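(* The Galois-stable cyclic subgroups of order $4$ of an elliptic curve over $\mathbf{Q}$ come in pairs, in the following sense. Let $E/\mathbf{Q}$ be an elliptic curve and $G$ a Galois-stable cyclic subgroup of order $4$ of $E$. Take a model $y^2=x(x^2+\gamma x+\delta^2)$ of $E$ over $\mathbf{Q}$, with $\gamma\in\mathbf{Q}$, $\delta\in\mathbf{Q}^\times$, $\gamma^2-4\delta^2\ne0$, in which the point of order $2$ of $G$ is $(0,0)$ (such a model exists). Then there is exactly one other Galois-stable cyclic subgroup $G'\neq G$ of order $4$ containing $(0,0)$; the $x$-coordinate of the generators of $G'$ is the negative of the $x$-coordinate of the generators of $G$; the intersection $G\cap G'$ is the subgroup of order $2$ of each of $G$ and $G'$; and the point generating this subgroup of order $2$ is $\mathbf{Q}$-rational.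
   Context: A cyclic subgroup of order $4$ of $E(\overline{\mathbf{Q}})$ is Galois-stable if it is mapped to itself by every element of $\mathrm{Gal}(\overline{\mathbf{Q}}/\mathbf{Q})$. A model of $E/\mathbf{Q}$ is a Weierstrass equation over $\mathbf{Q}$ defining an elliptic curve isomorphic to $E$ over $\mathbf{Q}$. *)

theory Defs
  imports "HOL-Algebra.Algebraic_Closure_Type" "HOL-Algebra.Generated_Groups"
begin

(* Weierstrass a1 a2 a3 a4 a6 is the equation
     y^2 + a1 x y + a3 y = x^3 + a2 x^2 + a4 x + a6. *)
datatype 'a weierstrass = Weierstrass (a1: 'a) (a2: 'a) (a3: 'a) (a4: 'a) (a6: 'a)

datatype 'a ec_point = Infinity | Affine 'a 'a

definition discriminant :: "'a::comm_ring_1 weierstrass \<Rightarrow> 'a" where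
  "discriminant W =
    (let b2 = a1 W ^ 2 + 4 * a2 W;
         b4 = 2 * a4 W + a1 W * a3 W;
         b6 = a3 W ^ 2 + 4 * a6 W;
         b8 = a1 W ^ 2 * a6 W + 4 * a2 W * a6 W - a1 W * a3 W * a4 W + a2 W * a3 W ^ 2 - a4 W ^ 2
     in - (b2 ^ 2 * b8) - 8 * b4 ^ 3 - 27 * b6 ^ 2 + 9 * b2 * b4 * b6)"

definition elliptic :: "'a::comm_ring_1 weierstrass \<Rightarrow> bool" where
  "elliptic W \<longleftrightarrow> discriminant W \<noteq> 0"

fun on_curve :: "'a::comm_ring_1 weierstrass \<Rightarrow> 'a ec_point \<Rightarrow> bool" where
  "on_curve W Infinity \<longleftrightarrow> True"
| "on_curve W (Affine x y) \<longleftrightarrow>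
     y ^ 2 + a1 W * x * y + a3 W * y = x ^ 3 + a2 W * x ^ 2 + a4 W * x + a6 W"

(* Chord-and-tangent addition: the line y = l x + n through the two points (the tangent line
   if they coincide) meets the curve in a third point, which is then negated. *)
fun ec_add :: "'a::field weierstrass \<Rightarrow> 'a ec_point \<Rightarrow> 'a ec_point \<Rightarrow> 'a ec_point" where
  "ec_add W Infinity Q = Q"
| "ec_add W P Infinity = P"
| "ec_add W (Affine x1 y1) (Affine x2 y2) =
     (if x1 = x2 \<and> y1 + y2 + a1 W * x2 + a3 W = 0 then Infinity
      else
        let l = (if x1 = x2
                 then (3 * x1 ^ 2 + 2 * a2 W * x1 + a4 W - a1 W * y1) / (2 * y1 + a1 W * x1 + a3 W)
                 else (y2 - y1) / (x2 - x1));
            n = y1 - l * x1;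
            x3 = l ^ 2 + a1 W * l - a2 W - x1 - x2
        in Affine x3 (- (l + a1 W) * x3 - n - a3 W))"

definition ec_group :: "'a::field weierstrass \<Rightarrow> 'a ec_point monoid" where
  "ec_group W = \<lparr>carrier = {P. on_curve W P}, monoid.mult = ec_add W, one = Infinity\<rparr>"

definition generates :: "('a, 'b) monoid_scheme \<Rightarrow> 'a set \<Rightarrow> 'a \<Rightarrow> bool" where
  "generates A H P \<longleftrightarrow> P \<in> H \<and> generate A {P} = H"

definition cyclic_subgroup :: "('a, 'b) monoid_scheme \<Rightarrow> nat \<Rightarrow> 'a set \<Rightarrow> bool" where
  "cyclic_subgroup A n H \<longleftrightarrow> subgroup H A \<and> card H = n \<and> (\<exists>P. generates A H P)"

definition order_two_points :: "('a, 'b) monoid_scheme \<Rightarrow> 'a set \<Rightarrow> 'a set" where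
  "order_two_points A H = {P \<in> H. P \<noteq> \<one>\<^bsub>A\<^esub> \<and> P \<otimes>\<^bsub>A\<^esub> P = \<one>\<^bsub>A\<^esub>}"

definition order_two_subgroups :: "('a, 'b) monoid_scheme \<Rightarrow> 'a set \<Rightarrow> 'a set set" where
  "order_two_subgroups A H = {K. subgroup K A \<and> card K = 2 \<and> K \<subseteq> H}"

type_synonym qbar = "rat alg_closure"

definition absolute_galois :: "(qbar \<Rightarrow> qbar) set" where
  "absolute_galois = {\<sigma>. bij \<sigma> \<and> (\<forall>q. \<sigma> (to_ac q) = to_ac q)
     \<and> (\<forall>x y. \<sigma> (x + y) = \<sigma> x + \<sigma> y) \<and> (\<forall>x y. \<sigma> (x * y) = \<sigma> x * \<sigma> y)}"

definition geometric_points :: "rat weierstrass \<Rightarrow> qbar ec_point monoid" where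
  "geometric_points E = ec_group (map_weierstrass to_ac E)"

definition rational_point :: "qbar ec_point \<Rightarrow> bool" where
  "rational_point P \<longleftrightarrow> P \<in> range (map_ec_point to_ac)"

definition galois_stable :: "qbar ec_point set \<Rightarrow> bool" where
  "galois_stable H \<longleftrightarrow> (\<forall>\<sigma>\<in>absolute_galois. map_ec_point \<sigma> ` H = H)"

definition stable_cyclic4 :: "rat weierstrass \<Rightarrow> qbar ec_point set \<Rightarrow> bool" where
  "stable_cyclic4 E H \<longleftrightarrow> cyclic_subgroup (geometric_points E) 4 H \<and> galois_stable H"

(* An isomorphism of elliptic curves given by Weierstrass equations is an admissible change of
   variables x = u^2 x' + r, y = u^3 y' + u^2 s x' + t with u nonzero. The next two functions
   are its effect on the equation and on points, old coordinates to new ones. *)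
definition change_curve :: "'a::field \<Rightarrow> 'a \<Rightarrow> 'a \<Rightarrow> 'a \<Rightarrow> 'a weierstrass \<Rightarrow> 'a weierstrass" where
  "change_curve u r s t W = Weierstrass
     ((a1 W + 2 * s) / u)
     ((a2 W - s * a1 W + 3 * r - s ^ 2) / u ^ 2)
     ((a3 W + r * a1 W + 2 * t) / u ^ 3)
     ((a4 W - s * a3 W + 2 * r * a2 W - (t + r * s) * a1 W + 3 * r ^ 2 - 2 * s * t) / u ^ 4)
     ((a6 W + r * a4 W + r ^ 2 * a2 W + r ^ 3 - t * a3 W - t ^ 2 - r * t * a1 W) / u ^ 6)"

fun change_point :: "'a::field \<Rightarrow> 'a \<Rightarrow> 'a \<Rightarrow> 'a \<Rightarrow> 'a ec_point \<Rightarrow> 'a ec_point" where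
  "change_point u r s t Infinity = Infinity"
| "change_point u r s t (Affine x y) = Affine ((x - r) / u ^ 2) ((y - s * (x - r) - t) / u ^ 3)"

lemma on_curve_change:
  assumes "u \<noteq> 0"
  shows "on_curve (change_curve u r s t W) (change_point u r s t P) \<longleftrightarrow> on_curve W P"
proof (cases P)
  case (Affine x y)
  define x' where "x' = (x - r) / u ^ 2"
  define y' where "y' = (y - s * (x - r) - t) / u ^ 3"
  define F where "F = (y ^ 2 + a1 W * x * y + a3 W * y) - (x ^ 3 + a2 W * x ^ 2 + a4 W * x + a6 W)"
  let ?C = "change_curve u r s t W"
  have x: "x = u ^ 2 * x' + r" and y: "y = u ^ 3 * y' + s * u ^ 2 * x' + t"
    using assms by (simp_all add: x'_def y'_def)
  obtain c1 c2 c3 c4 c6 where C: "?C = Weierstrass c1 c2 c3 c4 c6"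
    by (cases ?C)
  have a: "a1 W = u * c1 - 2 * s"
    "a2 W = u ^ 2 * c2 + s * a1 W - 3 * r + s ^ 2"
    "a3 W = u ^ 3 * c3 - r * a1 W - 2 * t"
    "a4 W = u ^ 4 * c4 + s * a3 W - 2 * r * a2 W + (t + r * s) * a1 W - 3 * r ^ 2 + 2 * s * t"
    "a6 W = u ^ 6 * c6 - r * a4 W - r ^ 2 * a2 W - r ^ 3 + t * a3 W + t ^ 2 + r * t * a1 W"
    using assms C by (auto simp add: change_curve_def)
  have "F = u ^ 6 * ((y' ^ 2 + c1 * x' * y' + c3 * y') - (x' ^ 3 + c2 * x' ^ 2 + c4 * x' + c6))"
    unfolding F_def a x y by (simp add: algebra_simps power_numeral_reduce)
  then have "F = 0 \<longleftrightarrow> y' ^ 2 + c1 * x' * y' + c3 * y' = x' ^ 3 + c2 * x' ^ 2 + c4 * x' + c6"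
    using assms by simp
  moreover have "F = 0 \<longleftrightarrow> on_curve W P"
    unfolding Affine F_def by simp
  moreover have "change_point u r s t P = Affine x' y'"
    unfolding Affine x'_def y'_def by simp
  ultimately show ?thesis
    unfolding C by simp
qed simp

(* The equation y^2 = x (x^2 + g x + d^2). *)
definition normal_form :: "rat \<Rightarrow> rat \<Rightarrow> rat weierstrass" where
  "normal_form g d = Weierstrass 0 g 0 (d ^ 2) 0"

abbreviation to_model ::
    "rat \<Rightarrow> rat \<Rightarrow> rat \<Rightarrow> rat \<Rightarrow> qbar ec_point \<Rightarrow> qbar ec_point" where
  "to_model u r s t \<equiv> change_point (to_ac u) (to_ac r) (to_ac s) (to_ac t)"

definition adapted_model ::
    "rat weierstrass \<Rightarrow> qbar ec_point set \<Rightarrow> rat \<Rightarrow> rat \<Rightarrow> rat \<Rightarrow> rat \<Rightarrow> rat \<Rightarrow> rat \<Rightarrow> bool" where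
  "adapted_model E G g d u r s t \<longleftrightarrow>
     d \<noteq> 0 \<and> g ^ 2 - 4 * d ^ 2 \<noteq> 0 \<and> u \<noteq> 0 \<and> change_curve u r s t E = normal_form g d \<and>
     to_model u r s t ` order_two_points (geometric_points E) G = {Affine 0 0}"

end

theory Submission
  imports Defs
begin

text \<open>
  Move the point of order two of a cyclic group of order four to the origin. The curve becomes
  \<open>y\<^sup>2 = x (x\<^sup>2 + g x + D)\<close>, and the \<open>x\<close>-coordinate of the double of \<open>(x, y)\<close> is
  \<open>(x\<^sup>2 - D)\<^sup>2 / (4 y\<^sup>2)\<close>. Hence a point doubles to the origin exactly when \<open>x\<^sup>2 = D\<close>
  (\<open>x_of_half_of_origin\<close>, \<open>half_of_origin_table\<close>). When \<open>D = \<delta>\<^sup>2\<close> the two solutions \<open>\<delta>\<close> and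
  \<open>- \<delta>\<close> give two groups of order four, each consisting of infinity, the origin and the two points
  with that \<open>x\<close>-coordinate; such a set depends on \<open>x\<close> only, so it is stable under Galois because
  \<open>\<plusminus> \<delta>\<close> is rational. These are the two members of the pair (\<open>cyclic_4_over_origin\<close>,
  \<open>stable_cyclic4_fibre\<close>), and all the remaining assertions are read off from their shape.

  For the existence of the model, let \<open>P\<close> generate the stable group \<open>G\<close>. The point \<open>2P\<close> is the
  only one of order two in \<open>G\<close>, so it is fixed by Galois, and the generators \<open>P\<close> and \<open>- P\<close> share
  their \<open>x\<close>-coordinate, which is therefore fixed too. As the fixed field of the automorphisms is the
  base field, the translation taking \<open>2P\<close> to the origin is rational, and so is the difference
  \<open>\<delta>\<close> of the \<open>x\<close>-coordinates of \<open>P\<close> and \<open>2P\<close>. The halving formula then says that the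
  coefficient of \<open>x\<close> is \<open>\<delta>\<^sup>2\<close>.

  The fixed field is determined by extending isomorphisms. A non-rational element has a second
  conjugate, by separability, and sending it there defines an embedding of a subfield; a maximal
  extension of that embedding, given by Zorn's lemma, is defined on the whole closure.

  A cyclic group of order four is \<open>{O, P, 2P, -P}\<close> with a known addition table
  (\<open>generator_of_cyclic_4\<close>, \<open>cyclic_4_of_table\<close>), so the group theory reduces to
  the chord-and-tangent formulas for the few sums in that table.
\<close>

section \<open>Automorphisms of an algebraic closure and their fixed field\<close>

definition automorphism_over_base :: "('k::field alg_closure \<Rightarrow> 'k alg_closure) \<Rightarrow> bool" where
  "automorphism_over_base \<sigma> \<longleftrightarrow> bij \<sigma> \<and> (\<forall>q. \<sigma> (to_ac q) = to_ac q)
     \<and> (\<forall>x y. \<sigma> (x + y) = \<sigma> x + \<sigma> y) \<and> (\<forall>x y. \<sigma> (x * y) = \<sigma> x * \<sigma> y)"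

text \<open>
  A partial embedding is the graph of a homomorphism from a subring of the closure into the closure.
  As a set of pairs it is a subring of the product ring whose first projection is injective, which
  makes extending it and taking unions of chains plain set operations. Every element being algebraic,
  the domain is automatically a field.
\<close>

definition partial_embedding :: "('k::field alg_closure \<times> 'k alg_closure) set \<Rightarrow> bool" where
  "partial_embedding R \<longleftrightarrow>
     (\<forall>q. (to_ac q, to_ac q) \<in> R) \<and>
     (\<forall>x y x' y'. (x, y) \<in> R \<longrightarrow> (x', y') \<in> R \<longrightarrow> (x + x', y + y') \<in> R \<and> (x * x', y * y') \<in> R) \<and>
     (\<forall>y. (0, y) \<in> R \<longrightarrow> y = 0)"

text \<open>
  For a graph \<open>R\<close> of a homomorphism \<open>f\<close>, this says that \<open>p\<close> has coefficients in the domain of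
  \<open>f\<close> and that \<open>q\<close> arises from \<open>p\<close> by applying \<open>f\<close> to them.
\<close>

definition coeffs_related :: "('a::zero \<times> 'a) set \<Rightarrow> 'a poly \<Rightarrow> 'a poly \<Rightarrow> bool" where
  "coeffs_related R p q \<longleftrightarrow> (\<forall>i. (poly.coeff p i, poly.coeff q i) \<in> R)"

definition adjoin :: "('a::comm_semiring_0 \<times> 'a) set \<Rightarrow> 'a \<Rightarrow> 'a \<Rightarrow> ('a \<times> 'a) set" where
  "adjoin R a b = {(poly p a, poly q b) | p q. coeffs_related R p q}"

text \<open>
  The polynomial \<open>m\<close> is the minimal polynomial of \<open>a\<close> over the domain of the homomorphism with
  graph \<open>R\<close>, and \<open>n\<close> is its image.
\<close>

definition minimal_pair :: "('a::comm_semiring_1 \<times> 'a) set \<Rightarrow> 'a \<Rightarrow> 'a poly \<Rightarrow> 'a poly \<Rightarrow> bool" where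
  "minimal_pair R a m n \<longleftrightarrow>
     coeffs_related R m n \<and> poly m a = 0 \<and> lead_coeff m = 1 \<and> 0 < Polynomial.degree m \<and>
     (\<forall>p q. coeffs_related R p q \<longrightarrow> poly p a = 0 \<longrightarrow> p \<noteq> 0 \<longrightarrow>
       Polynomial.degree m \<le> Polynomial.degree p)"

context
  fixes R :: "('k::field alg_closure \<times> 'k alg_closure) set"
  assumes R: "partial_embedding R"
begin

lemma rel_base: "(to_ac q, to_ac q) \<in> R"
  and rel_add: "(x, y) \<in> R \<Longrightarrow> (x', y') \<in> R \<Longrightarrow> (x + x', y + y') \<in> R"
  and rel_mult: "(x, y) \<in> R \<Longrightarrow> (x', y') \<in> R \<Longrightarrow> (x * x', y * y') \<in> R"
  and rel_0D: "(0, y) \<in> R \<Longrightarrow> y = 0"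
  using R by (auto simp: partial_embedding_def)

lemma rel_0: "(0, 0) \<in> R" and rel_1: "(1, 1) \<in> R"
  using rel_base[of 0] rel_base[of 1] by simp_all

lemma rel_diff: "(x, y) \<in> R \<Longrightarrow> (x', y') \<in> R \<Longrightarrow> (x - x', y - y') \<in> R"
  using rel_add[of x y "- x'" "- y'"] rel_mult[of x' y' "-1" "-1"] rel_base[of "-1"] by simp

lemma rel_unique: "(x, y) \<in> R \<Longrightarrow> (x, y') \<in> R \<Longrightarrow> y = y'"
  using rel_diff[of x y x y'] rel_0D by fastforce

lemma rel_sum: "(\<And>i. i \<in> A \<Longrightarrow> (f i, g i) \<in> R) \<Longrightarrow> (sum f A, sum g A) \<in> R"
  by (induction A rule: infinite_finite_induct) (auto intro: rel_0 rel_add)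

lemma rel_poly_base:
  assumes "(x, y) \<in> R"
  shows "(poly (map_poly to_ac p) x, poly (map_poly to_ac p) y) \<in> R"
proof (induction p)
  case 0
  show ?case by (simp add: rel_0)
next
  case (pCons a p)
  then show ?case
    using assms rel_base by (auto simp: map_poly_pCons intro!: rel_add rel_mult)
qed

text \<open>
  An algebraic equation for \<open>x\<close> over the base field, divided by a power of \<open>x\<close> so that its constant
  term is nonzero, expresses the inverse of \<open>x\<close> as a polynomial in \<open>x\<close>. The induction on the
  polynomial performs this division one factor at a time.
\<close>

lemma rel_inverse:
  assumes xy: "(x, y) \<in> R" and "x \<noteq> 0"
  shows "\<exists>z. (inverse x, z) \<in> R"
proof -
  obtain p :: "'k poly" where "p \<noteq> 0" "poly (map_poly to_ac p) x = 0"
    by (rule alg_closure_algebraic)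
  then show ?thesis
  proof (induction p)
    case (pCons a p)
    have eq: "to_ac a + x * poly (map_poly to_ac p) x = 0"
      using pCons.prems by (simp add: map_poly_pCons pCons.hyps)
    show ?case
    proof (cases "a = 0")
      case True
      then show ?thesis
        using eq pCons \<open>x \<noteq> 0\<close> by auto
    next
      case False
      have "inverse x = to_ac (- inverse a) * poly (map_poly to_ac p) x"
        using eq False \<open>x \<noteq> 0\<close> by (simp add: field_simps eq_neg_iff_add_eq_0)
      then show ?thesis
        using rel_mult[OF rel_base rel_poly_base[OF xy]] by metis
    qed
  qed simp
qed

lemma related_unique_0: "coeffs_related R 0 q \<Longrightarrow> q = 0"
  using rel_0D by (auto simp: coeffs_related_def intro!: poly_eqI)

lemma related_base: "coeffs_related R (map_poly to_ac p) (map_poly to_ac p)"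
  by (simp add: coeffs_related_def coeff_map_poly rel_base)

lemma related_add:
  "coeffs_related R p q \<Longrightarrow> coeffs_related R p' q' \<Longrightarrow> coeffs_related R (p + p') (q + q')"
  by (simp add: coeffs_related_def rel_add)

lemma related_diff:
  "coeffs_related R p q \<Longrightarrow> coeffs_related R p' q' \<Longrightarrow> coeffs_related R (p - p') (q - q')"
  by (simp add: coeffs_related_def rel_diff)

lemma related_mult:
  "coeffs_related R p q \<Longrightarrow> coeffs_related R p' q' \<Longrightarrow> coeffs_related R (p * p') (q * q')"
  by (simp add: coeffs_related_def coeff_mult rel_sum rel_mult)

lemma related_monom: "(x, y) \<in> R \<Longrightarrow> coeffs_related R (Polynomial.monom x n) (Polynomial.monom y n)"
  by (simp add: coeffs_related_def rel_0)

text \<open>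
  The homomorphism sends 0 to 0 and 1 to 1, and these are the only values paired with 0 and 1.
\<close>

lemma degree_related_monic:
  assumes "coeffs_related R p q" and "lead_coeff p = 1"
  shows "Polynomial.degree q = Polynomial.degree p"
proof -
  have 1: "poly.coeff q (Polynomial.degree p) = 1"
    using assms rel_unique[OF _ rel_1] by (auto simp: coeffs_related_def dest: spec[of _ "Polynomial.degree p"])
  have "Polynomial.degree q \<le> Polynomial.degree p"
  proof (rule degree_le, intro allI impI)
    fix i assume "Polynomial.degree p < i"
    then show "poly.coeff q i = 0"
      using assms(1) rel_0D by (metis coeff_eq_0 coeffs_related_def)
  qed
  with 1 show "Polynomial.degree q = Polynomial.degree p"
    by (metis le_antisym le_degree zero_neq_one)
qed

lemma minimal_pair_exists: "\<exists>m n. minimal_pair R a m n"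
proof -
  define S where "S = (\<lambda>d. \<exists>p q. coeffs_related R p q \<and> poly p a = 0 \<and> p \<noteq> 0 \<and> Polynomial.degree p = d)"
  obtain b :: "'k poly" where "b \<noteq> 0" "poly (map_poly to_ac b) a = 0"
    by (rule alg_closure_algebraic)
  then have "S (Polynomial.degree (map_poly to_ac b))"
    unfolding S_def using related_base by (metis map_poly_eq_0_iff to_ac_0 to_ac_eq_0_iff)
  then have "S (LEAST d. S d)" and least: "\<And>d. S d \<Longrightarrow> (LEAST d. S d) \<le> d"
    by (auto intro: LeastI Least_le)
  then obtain p q where pq: "coeffs_related R p q" "poly p a = 0" "p \<noteq> 0"
    "Polynomial.degree p = (LEAST d. S d)"
    unfolding S_def by blast
  then obtain z where z: "(inverse (lead_coeff p), z) \<in> R"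
    using rel_inverse[of "lead_coeff p"] by (metis coeffs_related_def leading_coeff_0_iff)
  let ?m = "Polynomial.smult (inverse (lead_coeff p)) p"
  have deg: "Polynomial.degree ?m = (LEAST d. S d)"
    using pq(3) by (simp flip: pq(4))
  have "coeffs_related R ?m (Polynomial.smult z q)"
    using pq(1) z rel_mult by (simp add: coeffs_related_def)
  moreover have "poly ?m a = 0" "lead_coeff ?m = 1"
    using pq(2,3) by simp_all
  moreover have "Polynomial.degree ?m > 0"
    using pq(2,3) by (auto elim!: degree_eq_zeroE intro!: Nat.gr0I)
  moreover have "Polynomial.degree ?m \<le> Polynomial.degree p'"
    if "coeffs_related R p' q'" "poly p' a = 0" "p' \<noteq> 0" for p' q'
    unfolding deg using that by (intro least) (auto simp: S_def)
  ultimately show ?thesis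
    unfolding minimal_pair_def by blast
qed

text \<open>
  This is what makes \<open>a \<mapsto> b\<close> a well-defined extension of the homomorphism. Division with remainder
  of \<open>p\<close> by \<open>m\<close> can be copied on the images, because \<open>m\<close> is monic; minimality forces the
  remainder to vanish.
\<close>

lemma minimal_pair_root:
  assumes mn: "minimal_pair R a m n" and nb: "poly n b = 0"
    and "coeffs_related R p q" and "poly p a = 0"
  shows "poly q b = 0"
proof -
  have "p = 0 \<or> Polynomial.degree p < d \<Longrightarrow> coeffs_related R p q \<Longrightarrow> poly p a = 0 \<Longrightarrow> poly q b = 0" for d
  proof (induction d arbitrary: p q)
    case 0
    then have "q = 0" using related_unique_0 by simp
    then show ?case by simp
  next
    case (Suc d)
    show ?case
    proof (cases "p = 0")
      case True
      then have "q = 0" using Suc.prems(2) related_unique_0 by simp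
      then show ?thesis by simp
    next
      case False
      define k where "k = Polynomial.degree p - Polynomial.degree m"
      have k: "Polynomial.degree p = k + Polynomial.degree m"
        using mn Suc.prems(2,3) False by (fastforce simp: k_def minimal_pair_def)
      \<comment> \<open>One step of the division: cancel the leading term of \<open>p\<close>, and do the same to \<open>q\<close>.\<close>
      define c where "c = Polynomial.monom (lead_coeff p) k"
      define e where "e = Polynomial.monom (poly.coeff q (Polynomial.degree p)) k"
      have rel: "coeffs_related R (p - c * m) (q - e * n)"
        unfolding c_def e_def using Suc.prems(2) mn
        by (intro related_diff related_mult related_monom)
          (auto simp: coeffs_related_def minimal_pair_def)
      have "Polynomial.degree (c * m) \<le> Polynomial.degree p"
        unfolding k c_def by (metis add_mono_thms_linordered_semiring(3) degree_monom_le degree_mult_le order_trans)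
      then have "Polynomial.degree (p - c * m) \<le> Polynomial.degree p"
        by (intro degree_diff_le) auto
      moreover have "poly.coeff (p - c * m) (Polynomial.degree p) = 0"
        using mn by (simp add: c_def coeff_monom_mult k minimal_pair_def)
      ultimately have "p - c * m = 0 \<or> Polynomial.degree (p - c * m) < d"
        using Suc.prems(1) False
        by (metis leading_coeff_0_iff le_neq_implies_less less_Suc_eq_le order_less_le_trans)
      then have "poly (q - e * n) b = 0"
        using rel
        by (rule Suc.IH) (use mn in \<open>simp add: Suc.prems(3) minimal_pair_def\<close>)
      then show ?thesis by (simp add: nb)
    qed
  qed
  with assms(3,4) show ?thesis by blast
qed

lemma partial_embedding_adjoin:
  assumes "minimal_pair R a m n" and "poly n b = 0"
  shows "partial_embedding (adjoin R a b)"
  unfolding partial_embedding_def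
proof (intro conjI allI impI)
  fix q
  have "coeffs_related R [:to_ac q:] [:to_ac q:]"
    using related_base[of "[:q:]"] by (simp add: map_poly_pCons)
  then show "(to_ac q, to_ac q) \<in> adjoin R a b"
    by (force simp: adjoin_def)
next
  fix x y x' y'
  assume "(x, y) \<in> adjoin R a b" "(x', y') \<in> adjoin R a b"
  then obtain p q p' q' where *: "coeffs_related R p q" "x = poly p a" "y = poly q b"
      "coeffs_related R p' q'" "x' = poly p' a" "y' = poly q' b"
    unfolding adjoin_def by blast
  show "(x + x', y + y') \<in> adjoin R a b"
    using related_add[OF *(1,4)] * by (force simp: adjoin_def)
  show "(x * x', y * y') \<in> adjoin R a b"
    using related_mult[OF *(1,4)] * by (force simp: adjoin_def)
next
  fix y assume "(0, y) \<in> adjoin R a b"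
  then show "y = 0"
    unfolding adjoin_def using minimal_pair_root[OF assms] by auto
qed

lemma adjoin_extends: "R \<subseteq> adjoin R a b"
proof
  fix z assume "z \<in> R"
  then have "coeffs_related R [:fst z:] [:snd z:]"
    by (auto simp: coeffs_related_def coeff_pCons rel_0 split: nat.split)
  then show "z \<in> adjoin R a b"
    by (cases z) (force simp: adjoin_def)
qed

lemma adjoin_contains: "(a, b) \<in> adjoin R a b"
proof -
  have "coeffs_related R [:0, 1:] [:0, 1:]"
    by (auto simp: coeffs_related_def coeff_pCons rel_0 rel_1 split: nat.split)
  then show ?thesis
    by (force simp: adjoin_def)
qed

end

lemma partial_embedding_Union:
  assumes "C \<noteq> {}" "\<And>R. R \<in> C \<Longrightarrow> partial_embedding R"
    and chain: "\<And>R S. R \<in> C \<Longrightarrow> S \<in> C \<Longrightarrow> R \<subseteq> S \<or> S \<subseteq> R"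
  shows "partial_embedding (\<Union>C)"
  unfolding partial_embedding_def
proof (intro conjI allI impI)
  show "(to_ac q, to_ac q) \<in> \<Union>C" for q
    using assms by (auto simp: partial_embedding_def)
next
  fix x y x' y' assume "(x, y) \<in> \<Union>C" "(x', y') \<in> \<Union>C"
  then obtain R where "R \<in> C" "(x, y) \<in> R" "(x', y') \<in> R"
    using chain by blast
  then show "(x + x', y + y') \<in> \<Union>C" "(x * x', y * y') \<in> \<Union>C"
    using assms(2)[of R] by (auto simp: partial_embedding_def intro!: bexI[of _ R])
next
  fix y assume "(0, y) \<in> \<Union>C"
  then show "y = 0" using assms(2) by (auto simp: partial_embedding_def)
qed

text \<open>
  A homomorphism over the base field is injective because it preserves inverses. It is onto because it
  permutes the finitely many roots of any polynomial with coefficients in the base field.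
\<close>

lemma bij_embedding:
  fixes \<sigma> :: "'k::field alg_closure \<Rightarrow> 'k alg_closure"
  assumes base: "\<And>q. \<sigma> (to_ac q) = to_ac q"
    and add: "\<And>x y. \<sigma> (x + y) = \<sigma> x + \<sigma> y" and mult: "\<And>x y. \<sigma> (x * y) = \<sigma> x * \<sigma> y"
  shows "bij \<sigma>"
proof -
  have 0: "\<sigma> 0 = 0" and 1: "\<sigma> 1 = 1"
    using base[of 0] base[of 1] by simp_all
  have inj: "inj \<sigma>"
  proof (rule injI)
    fix x y assume "\<sigma> x = \<sigma> y"
    then have "\<sigma> (x - y) = 0"
      using add[of "x - y" y] by simp
    then have "x - y = 0"
      using mult[of "x - y" "inverse (x - y)"] 1 by (cases "x - y = 0") auto
    then show "x = y" by simp
  qed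
  have "\<exists>x. \<sigma> x = y" for y
  proof -
    obtain p :: "'k poly" where p: "p \<noteq> 0" "poly (map_poly to_ac p) y = 0"
      by (rule alg_closure_algebraic)
    define Z where "Z = {x. poly (map_poly to_ac p) x = 0}"
    have "map_poly to_ac p \<noteq> 0"
      using p(1) by (metis map_poly_eq_0_iff to_ac_0 to_ac_eq_0_iff)
    then have "finite Z"
      unfolding Z_def by (rule poly_roots_finite)
    have "poly (map_poly to_ac p) (\<sigma> x) = \<sigma> (poly (map_poly to_ac p) x)" for x
      by (induction p) (simp_all add: 0 base add mult map_poly_pCons)
    then have "\<sigma> ` Z \<subseteq> Z"
      by (auto simp: Z_def 0)
    then have "\<sigma> ` Z = Z"
      using \<open>finite Z\<close> inj by (meson endo_inj_surj inj_on_subset subset_UNIV)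
    moreover have "y \<in> Z"
      by (simp add: Z_def p)
    ultimately have "y \<in> \<sigma> ` Z" by simp
    then show ?thesis by auto
  qed
  with inj show ?thesis
    by (metis bijI surjI)
qed

text \<open>
  A maximal extension is total: otherwise a missing element \<open>x\<close> could be adjoined, sent to any root
  of the image of its minimal polynomial, and such a root exists in an algebraically closed field.
\<close>

theorem partial_embedding_extends_to_automorphism:
  assumes R: "partial_embedding R"
  obtains \<sigma> where "automorphism_over_base \<sigma>" "\<And>x y. (x, y) \<in> R \<Longrightarrow> \<sigma> x = y"
proof -
  define A where "A = {S. partial_embedding S \<and> R \<subseteq> S}"
  have "\<exists>M\<in>A. \<forall>S\<in>A. M \<subseteq> S \<longrightarrow> S = M"
  proof (rule subset_Zorn_nonempty)
    show "A \<noteq> {}"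
      using R by (auto simp: A_def)
    show "\<Union>C \<in> A" if "C \<noteq> {}" "subset.chain A C" for C
      using that partial_embedding_Union[of C]
      by (auto simp: A_def subset.chain_def)
  qed
  then obtain M where M: "partial_embedding M" "R \<subseteq> M"
    and max: "\<And>S. partial_embedding S \<Longrightarrow> M \<subseteq> S \<Longrightarrow> S = M"
    unfolding A_def by (metis (mono_tags, lifting) mem_Collect_eq order_trans)
  have "\<exists>y. (x, y) \<in> M" for x
  proof -
    obtain m n where mn: "minimal_pair M x m n"
      using minimal_pair_exists[OF M(1)] by blast
    obtain y where "poly n y = 0"
      using alg_closed_imp_poly_has_root[of n] degree_related_monic[OF M(1)] mn
      by (auto simp: minimal_pair_def)
    then have "adjoin M x y = M"
      using max partial_embedding_adjoin[OF M(1) mn] adjoin_extends[OF M(1)] by blast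
    then show ?thesis
      using adjoin_contains[OF M(1), of x y] by auto
  qed
  then obtain \<sigma> where \<sigma>: "\<And>x. (x, \<sigma> x) \<in> M"
    by metis
  have eq: "\<sigma> x = y" if "(x, y) \<in> M" for x y
    using rel_unique[OF M(1) \<sigma> that] .
  have hom: "\<sigma> (to_ac q) = to_ac q" "\<sigma> (x + y) = \<sigma> x + \<sigma> y" "\<sigma> (x * y) = \<sigma> x * \<sigma> y" for q x y
    by (intro eq rel_base rel_add rel_mult M(1) \<sigma>)+
  then have "automorphism_over_base \<sigma>"
    by (simp add: automorphism_over_base_def bij_embedding)
  then show thesis
    using that eq M(2) by blast
qed

text \<open>
  In characteristic zero the minimal polynomial \<open>m\<close> of \<open>x\<close> has \<open>x\<close> as a simple root. If its degree
  exceeds one, it has another root \<open>y\<close>, and some automorphism takes \<open>x\<close> to \<open>y\<close>.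
\<close>

theorem fixed_by_automorphisms_imp_base:
  fixes x :: "'k::field_char_0 alg_closure"
  assumes fixed: "\<And>\<sigma>. automorphism_over_base \<sigma> \<Longrightarrow> \<sigma> x = x"
  shows "x \<in> range to_ac"
proof -
  define R where "R = range (\<lambda>q :: 'k. (to_ac q, to_ac q))"
  have R: "partial_embedding R"
    unfolding partial_embedding_def R_def by (auto simp flip: to_ac_add to_ac_mult)
  obtain m n where mn: "minimal_pair R x m n"
    using minimal_pair_exists[OF R] by blast
  have rel: "coeffs_related R m n" and root: "poly m x = 0" and monic: "lead_coeff m = 1"
    and pos: "Polynomial.degree m > 0"
    using mn by (auto simp: minimal_pair_def)
  \<comment> \<open>Over the base field the embedding is the inclusion, so both members of the pair agree.\<close>
  have "poly.coeff n i = poly.coeff m i" for i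
    using rel by (auto simp: coeffs_related_def R_def dest: spec[of _ i])
  then have "n = m"
    by (rule poly_eqI)
  obtain h where h: "m = [:- x, 1:] * h"
    using root by (auto simp: poly_eq_0_iff_dvd)
  have "h \<noteq> 0" using h pos by auto
  \<comment> \<open>The derivative has smaller degree, so minimality prevents it from vanishing at \<open>x\<close>.\<close>
  have "coeffs_related R (pderiv m) (pderiv m)"
    using rel rel_mult[OF R] rel_base[OF R, of "of_nat i" for i] unfolding \<open>n = m\<close>
    by (auto simp: coeffs_related_def coeff_pderiv simp flip: of_nat_Suc)
  moreover have "pderiv m \<noteq> 0" "Polynomial.degree (pderiv m) < Polynomial.degree m"
    using pos by (auto simp: pderiv_eq_0_iff degree_pderiv)
  ultimately have "poly (pderiv m) x \<noteq> 0"
    using mn by (fastforce simp: minimal_pair_def)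
  then have hx: "poly h x \<noteq> 0"
    unfolding h pderiv_mult by (auto simp: pderiv_pCons)
  have deg: "Polynomial.degree m = Suc (Polynomial.degree h)"
    unfolding h using \<open>h \<noteq> 0\<close> by (subst degree_mult_eq) auto
  have "Polynomial.degree h = 0"
  proof (rule ccontr)
    assume "Polynomial.degree h \<noteq> 0"
    then obtain y where y: "poly h y = 0"
      using alg_closed_imp_poly_has_root[of h] by auto
    then have "poly n y = 0"
      by (simp add: \<open>n = m\<close> h)
    then obtain \<sigma> where "automorphism_over_base \<sigma>" "\<sigma> x = y"
      using partial_embedding_extends_to_automorphism[OF partial_embedding_adjoin[OF R mn]]
        adjoin_contains[OF R] by metis
    then show False
      using fixed y hx by metis
  qed
  then obtain e where "h = [:e:]"
    by (rule degree_eq_zeroE)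
  then have "poly.coeff m 0 = - x"
    using monic deg by (auto simp: h)
  then have "(- x, - x) \<in> R"
    using rel unfolding \<open>n = m\<close> coeffs_related_def by metis
  then obtain q where "- x = to_ac q"
    by (auto simp: R_def)
  then have "x = to_ac (- q)"
    by (metis minus_minus to_ac_minus)
  then show ?thesis by blast
qed

section \<open>Chord-and-tangent addition and negation\<close>

fun ec_neg :: "'a::field weierstrass \<Rightarrow> 'a ec_point \<Rightarrow> 'a ec_point" where
  "ec_neg W Infinity = Infinity"
| "ec_neg W (Affine x y) = Affine x (- y - a1 W * x - a3 W)"

lemma ec_neg_neg [simp]: "ec_neg W (ec_neg W P) = P"
  by (cases P) simp_all

lemma ec_neg_eq_Infinity [simp]: "ec_neg W P = Infinity \<longleftrightarrow> P = Infinity"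
  and ec_neg_eq_Infinity' [simp]: "Infinity = ec_neg W P \<longleftrightarrow> P = Infinity"
  by (cases P; simp)+

lemma ec_neg_Affine_eq_iff:
  "ec_neg W (Affine x1 y1) = Affine x2 y2 \<longleftrightarrow> x1 = x2 \<and> y1 + y2 + a1 W * x2 + a3 W = 0"
proof -
  have "- y1 - a1 W * x2 - a3 W - y2 = - (y1 + y2 + a1 W * x2 + a3 W)"
    by (simp add: algebra_simps)
  then have "- y1 - a1 W * x2 - a3 W = y2 \<longleftrightarrow> y1 + y2 + a1 W * x2 + a3 W = 0"
    by (metis eq_iff_diff_eq_0 neg_equal_0_iff_equal)
  then show ?thesis
    by auto
qed

lemma on_curve_neg [simp]: "on_curve W (ec_neg W P) \<longleftrightarrow> on_curve W P"
  by (cases P) (simp_all add: algebra_simps power2_eq_square)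

lemma ec_add_Infinity [simp]: "ec_add W P Infinity = P"
  by (cases P) simp_all

lemma ec_add_eq_Infinity_iff: "ec_add W P Q = Infinity \<longleftrightarrow> ec_neg W P = Q"
proof (cases P; cases Q)
  fix x y x' y' assume "P = Affine x y" "Q = Affine x' y'"
  then show ?thesis
    by (simp add: ec_neg_Affine_eq_iff Let_def del: ec_neg.simps)
qed auto

lemma on_curve_same_x:
  assumes "on_curve W (Affine x y)" "on_curve W (Affine x y')"
  shows "y' = y \<or> ec_neg W (Affine x y) = Affine x y'"
proof -
  have "(y' - y) * (y' + y + a1 W * x + a3 W) = 0"
    using assms by (simp add: algebra_simps power2_eq_square)
  then have "y' = y \<or> y + y' + a1 W * x + a3 W = 0"
    by (auto simp: add.commute)
  then show ?thesis
    by (simp only: ec_neg_Affine_eq_iff simp_thms)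
qed

definition slope :: "'a::field weierstrass \<Rightarrow> 'a \<Rightarrow> 'a \<Rightarrow> 'a \<Rightarrow> 'a \<Rightarrow> 'a" where
  "slope W x1 y1 x2 y2 =
     (if x1 = x2 then (3 * x1 ^ 2 + 2 * a2 W * x1 + a4 W - a1 W * y1) / (2 * y1 + a1 W * x1 + a3 W)
      else (y2 - y1) / (x2 - x1))"

text \<open>
  Keeping the slope \<open>l\<close> and the new coordinate \<open>x3\<close> as opaque parameters lets later computations
  substitute simplified values for them before anything is expanded.
\<close>

lemma ec_add_affine:
  assumes "ec_neg W (Affine x1 y1) \<noteq> Affine x2 y2" and "slope W x1 y1 x2 y2 = l"
    and "l ^ 2 + a1 W * l - a2 W - x1 - x2 = x3"
  shows "ec_add W (Affine x1 y1) (Affine x2 y2) = Affine x3 (- (l + a1 W) * x3 - (y1 - l * x1) - a3 W)"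
proof -
  have "ec_add W (Affine x1 y1) (Affine x2 y2) \<noteq> Infinity"
    using assms(1) by (simp only: ec_add_eq_Infinity_iff not_False_eq_True)
  then have "\<not> (x1 = x2 \<and> y1 + y2 + a1 W * x2 + a3 W = 0)"
    by auto
  then show ?thesis
    unfolding ec_add.simps Let_def assms(3)[symmetric] assms(2)[symmetric] slope_def by (simp only: if_False)
qed

text \<open>
  The third intersection point of the tangent line at \<open>(x, y)\<close> would have to be the point of that
  line above \<open>x\<close>, which is \<open>(x, y)\<close> itself, and the sum is its negative.
\<close>

lemma ec_add_self_same_x:
  assumes "ec_add W (Affine x y) (Affine x y) = Affine x y'"
  shows "Affine x y' = ec_neg W (Affine x y)"
proof -
  have "ec_neg W (Affine x y) \<noteq> Affine x y"
    using assms by (metis ec_add_eq_Infinity_iff ec_point.distinct(1))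
  then obtain l x3 where "Affine x y' = Affine x3 (- (l + a1 W) * x3 - (y - l * x) - a3 W)"
    using ec_add_affine[OF _ refl refl] assms by metis
  then have "x3 = x" and "y' = - (l + a1 W) * x - (y - l * x) - a3 W"
    by simp_all
  then show ?thesis
    unfolding \<open>y' = _\<close> by (simp add: algebra_simps)
qed

text \<open>
  Negation maps the tangent line at \<open>P\<close>, of slope \<open>l\<close>, to the tangent line at \<open>- P\<close>, of slope
  \<open>- l - a\<^sub>1\<close>.
\<close>

lemma ec_add_neg_neg: "ec_add W (ec_neg W P) (ec_neg W P) = ec_neg W (ec_add W P P)"
proof (cases "ec_neg W P = P")
  case True
  then have "ec_add W P P = Infinity"
    by (simp add: ec_add_eq_Infinity_iff)
  then show ?thesis
    unfolding True by simp
next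
  case False
  then obtain x y where P: "P = Affine x y"
    by (cases P) auto
  define y' where "y' = - y - a1 W * x - a3 W"
  define s where "s = 2 * y + a1 W * x + a3 W"
  define m where "m = 3 * x ^ 2 + 2 * a2 W * x + a4 W"
  have nP: "ec_neg W (Affine x y) = Affine x y'" and nP': "ec_neg W (Affine x y') = Affine x y"
    by (simp_all add: y'_def)
  have "y \<noteq> y'"
    using False unfolding P nP by simp
  have s: "s = y - y'" "2 * y' + a1 W * x + a3 W = y' - y"
    by (simp_all add: s_def y'_def)
  define l where "l = (m - a1 W * y) / (y - y')"
  have l: "slope W x y x y = l"
    by (simp add: slope_def l_def s flip: s_def m_def)
  have l': "slope W x y' x y' = - l - a1 W"
    using \<open>y \<noteq> y'\<close> unfolding slope_def s l_def
    by (simp add: divide_simps flip: m_def) (simp add: algebra_simps)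
  define x3 where "x3 = l ^ 2 + a1 W * l - a2 W - x - x"
  have x3: "(- l - a1 W) ^ 2 + a1 W * (- l - a1 W) - a2 W - x - x = x3"
    by (simp add: x3_def algebra_simps power2_eq_square)
  have "ec_add W P P = Affine x3 (- (l + a1 W) * x3 - (y - l * x) - a3 W)"
    unfolding P using \<open>y \<noteq> y'\<close> by (intro ec_add_affine[OF _ l x3_def[symmetric]]) (simp add: nP del: ec_neg.simps)
  moreover have "ec_add W (ec_neg W P) (ec_neg W P) =
      Affine x3 (- (- l - a1 W + a1 W) * x3 - (y' - (- l - a1 W) * x) - a3 W)"
    unfolding P nP using \<open>y \<noteq> y'\<close> by (intro ec_add_affine[OF _ l' x3]) (simp add: nP' del: ec_neg.simps)
  ultimately show ?thesis
    by (simp add: algebra_simps y'_def)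
qed

lemma carrier_ec_group [simp]: "P \<in> carrier (ec_group W) \<longleftrightarrow> on_curve W P"
  and mult_ec_group [simp]: "P \<otimes>\<^bsub>ec_group W\<^esub> Q = ec_add W P Q"
  and one_ec_group [simp]: "\<one>\<^bsub>ec_group W\<^esub> = Infinity"
  by (simp_all add: ec_group_def)

lemma inv_ec_group [simp]:
  assumes "on_curve W P"
  shows "inv\<^bsub>ec_group W\<^esub> P = ec_neg W P"
  unfolding m_inv_def
proof (rule the_equality)
  show "ec_neg W P \<in> carrier (ec_group W) \<and>
      P \<otimes>\<^bsub>ec_group W\<^esub> ec_neg W P = \<one>\<^bsub>ec_group W\<^esub> \<and>
      ec_neg W P \<otimes>\<^bsub>ec_group W\<^esub> P = \<one>\<^bsub>ec_group W\<^esub>"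
    using assms by (simp add: ec_add_eq_Infinity_iff)
qed (simp add: ec_add_eq_Infinity_iff)

text \<open>
  The inverse in the sense of \<open>m_inv\<close> is a definite description; by
  \<open>ec_add_eq_Infinity_iff\<close> the negative of a point is the only candidate for it.
\<close>

lemma subgroup_ec_group_iff:
  "subgroup H (ec_group W) \<longleftrightarrow>
     (\<forall>P\<in>H. on_curve W P \<and> ec_neg W P \<in> H) \<and> Infinity \<in> H \<and> (\<forall>P\<in>H. \<forall>Q\<in>H. ec_add W P Q \<in> H)"
  unfolding subgroup_def by (auto simp: subset_iff)

lemma generate_subset:
  assumes "subgroup H (ec_group W)" "S \<subseteq> H"
  shows "generate (ec_group W) S \<subseteq> H"
proof
  fix P assume "P \<in> generate (ec_group W) S"
  then show "P \<in> H"
    using assms by induction (auto simp: subgroup_ec_group_iff subset_iff)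
qed

lemma order_two_points_ec_group:
  "order_two_points (ec_group W) H = {P \<in> H. P \<noteq> Infinity \<and> ec_neg W P = P}"
  by (auto simp: order_two_points_def ec_add_eq_Infinity_iff)

section \<open>Cyclic subgroups of order four\<close>

lemma card_4_remaining:
  assumes "card H = 4" and "{a, b, c} \<subseteq> H" and "a \<noteq> b" "a \<noteq> c" "b \<noteq> c"
  obtains d where "H = {a, b, d, c}" "d \<notin> {a, b, c}"
proof -
  have "card (H - {a, b, c}) = 1"
    using assms by (subst card_Diff_subset) auto
  then obtain d where "H - {a, b, c} = {d}"
    by (auto simp: card_1_singleton_iff)
  then show thesis
    using that[of d] assms(2) by blast
qed

text \<open>
  The points \<open>O\<close>, \<open>P\<close> and \<open>- P\<close> are distinct, since otherwise they would form a smaller subgroup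
  containing the generator. The fourth element is its own negative, because negation permutes the
  group and is an involution on the other three. It must be \<open>2P\<close>: the value \<open>2P = - P\<close> would again
  make \<open>{O, P, -P}\<close> a subgroup, and \<open>2P = P\<close> is excluded by \<open>ec_add_self_same_x\<close>.
\<close>

lemma generator_of_cyclic_4:
  assumes H: "subgroup H (ec_group W)" and card: "card H = 4"
    and gen: "generates (ec_group W) H P"
  shows "H = {Infinity, P, ec_add W P P, ec_neg W P}"
    and "ec_neg W P \<noteq> P" "ec_add W P P \<noteq> Infinity" "ec_neg W (ec_add W P P) = ec_add W P P"
proof -
  have PH: "P \<in> H" and genH: "generate (ec_group W) {P} = H"
    using gen by (auto simp: generates_def)
  note sub = H[unfolded subgroup_ec_group_iff]
  have on: "on_curve W P" using sub PH by blast
  have small: "H \<subseteq> K" if "subgroup K (ec_group W)" "P \<in> K" for K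
    using generate_subset[OF that(1), of "{P}"] that(2) genH by simp
  have no_small: False if "H \<subseteq> {a, b, c}" for a b c
    using card_mono[OF _ that] card card_insert_le_m1[of 3 "{b, c}" a] card_insert_le_m1[of 2 "{c}" b] by simp
  show neq: "ec_neg W P \<noteq> P"
  proof
    assume *: "ec_neg W P = P"
    then have "ec_add W P P = Infinity" by (simp add: ec_add_eq_Infinity_iff)
    then have "H \<subseteq> {Infinity, P, P}"
      by (intro small) (auto simp: subgroup_ec_group_iff on *)
    then show False by (rule no_small)
  qed
  then have "P \<noteq> Infinity" by auto
  show 2: "ec_add W P P \<noteq> Infinity"
    using neq by (auto simp: ec_add_eq_Infinity_iff)
  obtain T where T: "H = {Infinity, P, T, ec_neg W P}" "T \<notin> {Infinity, P, ec_neg W P}"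
    by (rule card_4_remaining[OF card, of Infinity P "ec_neg W P"])
      (use sub PH neq \<open>P \<noteq> Infinity\<close> in auto)
  have "ec_neg W T \<in> H"
    using sub T(1) by blast
  then have negT: "ec_neg W T = T"
    using T by (metis ec_neg_eq_Infinity ec_neg_neg insert_iff singletonD)
  have not_neg: "ec_add W P P \<noteq> ec_neg W P"
  proof
    assume *: "ec_add W P P = ec_neg W P"
    then have "ec_add W (ec_neg W P) (ec_neg W P) = P"
      by (simp add: ec_add_neg_neg)
    then have "H \<subseteq> {Infinity, P, ec_neg W P}"
      using * on by (intro small) (auto simp: subgroup_ec_group_iff ec_add_eq_Infinity_iff[THEN iffD2])
    then show False by (rule no_small)
  qed
  have "ec_add W P P \<noteq> P"
  proof
    assume *: "ec_add W P P = P"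
    with ec_add_self_same_x[of W] \<open>P \<noteq> Infinity\<close> have "P = ec_neg W P"
      by (cases P) blast+
    with neq show False by simp
  qed
  moreover have "ec_add W P P \<in> H"
    using sub PH by blast
  ultimately have "ec_add W P P = T"
    using T(1) 2 not_neg by blast
  with T(1) negT show "H = {Infinity, P, ec_add W P P, ec_neg W P}" "ec_neg W (ec_add W P P) = ec_add W P P"
    by simp_all
qed

lemma order_two_points_cyclic_4:
  assumes "subgroup H (ec_group W)" "card H = 4" "generates (ec_group W) H P"
  shows "order_two_points (ec_group W) H = {ec_add W P P}"
proof -
  note P = generator_of_cyclic_4[OF assms]
  have "ec_neg W (ec_neg W P) \<noteq> ec_neg W P"
    using P(2) by (metis ec_neg_neg)
  then show ?thesis
    using P(2-4) by (subst P(1)) (auto simp: order_two_points_ec_group)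
qed

lemma order_two_subgroups_cyclic_4:
  assumes "subgroup H (ec_group W)" "card H = 4" "generates (ec_group W) H P"
  shows "order_two_subgroups (ec_group W) H = {{Infinity, ec_add W P P}}"
proof -
  note P = generator_of_cyclic_4[OF assms]
  let ?T = "ec_add W P P"
  have on: "on_curve W ?T"
    using assms P(1) by (auto simp: subgroup_ec_group_iff)
  have "ec_add W ?T ?T = Infinity"
    by (simp add: ec_add_eq_Infinity_iff P(4))
  then have "subgroup {Infinity, ?T} (ec_group W)"
    using on P(4) by (simp add: subgroup_ec_group_iff)
  moreover have "card {Infinity, ?T} = 2"
    using P(3) by simp
  moreover have "{Infinity, ?T} \<subseteq> H"
    by (subst P(1)) simp
  moreover have "K = {Infinity, ?T}" if K: "subgroup K (ec_group W)" "card K = 2" "K \<subseteq> H" for K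
  proof -
    have "Infinity \<in> K" using K(1) by (simp add: subgroup_ec_group_iff)
    then obtain S where S: "K = {Infinity, S}" "S \<noteq> Infinity"
      using K(2) by (auto simp: card_2_iff doubleton_eq_iff)
    then have "ec_neg W S \<in> K"
      using K(1) by (simp add: subgroup_ec_group_iff)
    then have "ec_neg W S = S"
      using S by auto
    then have "S \<in> order_two_points (ec_group W) H"
      using S K(3) by (auto simp: order_two_points_ec_group)
    then show ?thesis
      using S by (simp add: order_two_points_cyclic_4[OF assms])
  qed
  ultimately show ?thesis
    unfolding order_two_subgroups_def by blast
qed

text \<open>
  Infinity generates the trivial subgroup.
\<close>

lemma generator_of_order_two_subgroup:
  assumes "generates (ec_group W) {Infinity, T} S" "T \<noteq> Infinity"
  shows "S = T"
proof (rule ccontr)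
  assume "S \<noteq> T"
  then have "S = Infinity"
    using assms(1) by (auto simp: generates_def)
  moreover have "generate (ec_group W) {Infinity} \<subseteq> {Infinity}"
    by (rule generate_subset) (simp_all add: subgroup_ec_group_iff)
  ultimately show False
    using assms by (auto simp: generates_def)
qed

text \<open>
  Converse to \<open>generator_of_cyclic_4\<close>: together with the rules for negation, the assumed sums
  fill the addition table of \<open>{O, P, T, -P}\<close>.
\<close>

lemma cyclic_4_of_table:
  assumes P: "on_curve W P" and T: "on_curve W T" "T \<noteq> Infinity" "ec_neg W T = T"
    and PP: "ec_add W P P = T"
    and "ec_add W P T = ec_neg W P" "ec_add W T P = ec_neg W P"
      "ec_add W (ec_neg W P) T = P" "ec_add W T (ec_neg W P) = P"
  shows "cyclic_subgroup (ec_group W) 4 {Infinity, P, T, ec_neg W P}"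
proof -
  let ?H = "{Infinity, P, T, ec_neg W P}"
  have neg: "ec_add W P (ec_neg W P) = Infinity" "ec_add W (ec_neg W P) P = Infinity"
    "ec_add W T T = Infinity" "ec_add W (ec_neg W P) (ec_neg W P) = T"
    by (simp_all add: ec_add_eq_Infinity_iff T ec_add_neg_neg PP)
  have sub: "subgroup ?H (ec_group W)"
    using assms neg by (auto simp: subgroup_ec_group_iff)
  have "ec_neg W P \<noteq> P"
    using T(2) PP by (metis ec_add_eq_Infinity_iff)
  moreover have "P \<noteq> Infinity" "P \<noteq> T"
    using T PP \<open>ec_neg W P \<noteq> P\<close> by auto
  moreover have "ec_neg W P \<noteq> T"
    using T(3) \<open>P \<noteq> T\<close> by (metis ec_neg_neg)
  ultimately have "card ?H = 4"
    using T(2) by (auto simp: card_insert_if)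
  moreover have "generate (ec_group W) {P} = ?H"
  proof
    show "generate (ec_group W) {P} \<subseteq> ?H"
      using sub by (rule generate_subset) simp
    have "P \<in> generate (ec_group W) {P}"
      by (simp add: generate.incl)
    moreover have "Infinity \<in> generate (ec_group W) {P}"
      using generate.one[of "ec_group W" "{P}"] by simp
    moreover have "ec_neg W P \<in> generate (ec_group W) {P}"
      using generate.inv[of P "{P}" "ec_group W"] P by simp
    moreover have "T \<in> generate (ec_group W) {P}"
      using generate.eng[of P "ec_group W" "{P}" P] PP by (simp add: generate.incl)
    ultimately show "?H \<subseteq> generate (ec_group W) {P}" by simp
  qed
  ultimately show ?thesis
    using sub by (auto simp: cyclic_subgroup_def generates_def)
qed

section \<open>Change of coordinates\<close>

lemma inj_change_point:
  assumes "u \<noteq> 0"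
  shows "inj (change_point u r s t)"
proof (rule injI)
  fix P Q assume "change_point u r s t P = change_point u r s t Q"
  then show "P = Q"
    using assms by (cases P; cases Q) auto
qed

lemma surj_change_point:
  assumes "u \<noteq> 0"
  shows "surj (change_point u r s t)"
proof (rule surjI)
  fix P
  show "change_point u r s t (case P of Infinity \<Rightarrow> Infinity | Affine x y \<Rightarrow>
      Affine (u ^ 2 * x + r) (u ^ 3 * y + s * u ^ 2 * x + t)) = P"
    using assms by (cases P) auto
qed

lemma change_point_neg:
  assumes "u \<noteq> 0"
  shows "change_point u r s t (ec_neg W P) = ec_neg (change_curve u r s t W) (change_point u r s t P)"
  using assms by (cases P) (auto simp: change_curve_def field_simps power2_eq_square power3_eq_cube)

text \<open>
  A change of variables sends lines to lines: it turns slope \<open>l\<close> into \<open>(l - s) / u\<close>. The points must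
  lie on the curve, since two points with the same \<open>x\<close>-coordinate that are not negatives of each
  other then coincide and the tangent slope applies to both.
\<close>

lemma change_point_add:
  assumes u: "u \<noteq> 0" and on: "on_curve W P" "on_curve W Q"
  shows "change_point u r s t (ec_add W P Q) =
    ec_add (change_curve u r s t W) (change_point u r s t P) (change_point u r s t Q)"
proof (cases "P = Infinity \<or> Q = Infinity \<or> ec_neg W P = Q")
  case True
  then show ?thesis
  proof (elim disjE)
    assume "ec_neg W P = Q"
    then show ?thesis
      using u by (metis change_point.simps(1) change_point_neg ec_add_eq_Infinity_iff)
  qed auto
next
  case False
  then obtain x1 y1 x2 y2 where P: "P = Affine x1 y1" and Q: "Q = Affine x2 y2"
    by (metis ec_point.exhaust)
  let ?C = "change_curve u r s t W"
  define fx where "fx = (\<lambda>x. (x - r) / u ^ 2)"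
  define fy where "fy = (\<lambda>x y. (y - s * (x - r) - t) / u ^ 3)"
  have fP: "change_point u r s t P = Affine (fx x1) (fy x1 y1)"
    and fQ: "change_point u r s t Q = Affine (fx x2) (fy x2 y2)"
    by (simp_all add: P Q fx_def fy_def)
  have ninf: "ec_neg W (Affine x1 y1) \<noteq> Affine x2 y2"
    using False P Q by simp
  have ninf': "ec_neg ?C (Affine (fx x1) (fy x1 y1)) \<noteq> Affine (fx x2) (fy x2 y2)"
    using False u by (metis fP fQ change_point_neg inj_change_point injD)
  have fx_eq: "fx x1 = fx x2 \<longleftrightarrow> x1 = x2"
    using u by (auto simp: fx_def)
  define l where "l = slope W x1 y1 x2 y2"
  have l': "slope ?C (fx x1) (fy x1 y1) (fx x2) (fy x2 y2) = (l - s) / u"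
  proof (cases "x1 = x2")
    case True
    then have "y2 = y1"
      using on_curve_same_x[of W x2 y1 y2] on ninf unfolding P Q True by blast
    then have nz: "2 * y1 + a1 W * x1 + a3 W \<noteq> 0"
      using ninf unfolding ec_neg_Affine_eq_iff True by simp
    have d: "2 * fy x1 y1 + a1 ?C * fx x1 + a3 ?C = (2 * y1 + a1 W * x1 + a3 W) / u ^ 3"
      using u by (simp add: fx_def fy_def change_curve_def field_simps power2_eq_square power3_eq_cube)
    have n: "3 * fx x1 ^ 2 + 2 * a2 ?C * fx x1 + a4 ?C - a1 ?C * fy x1 y1 =
      (3 * x1 ^ 2 + 2 * a2 W * x1 + a4 W - a1 W * y1 - s * (2 * y1 + a1 W * x1 + a3 W)) / u ^ 4"
      using u by (simp add: fx_def fy_def change_curve_def field_simps power_numeral_reduce)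
    have "(N - s * D) / u ^ 4 / (D / u ^ 3) = (N / D - s) / u" if "D \<noteq> 0" for N D
      using u that by (simp add: divide_simps) (simp add: algebra_simps power_numeral_reduce)
    from this[OF nz] show ?thesis
      unfolding l_def slope_def fx_eq d n using True by simp
  next
    case False
    then have "x2 - x1 \<noteq> 0" by simp
    moreover have "fx x2 - fx x1 = (x2 - x1) / u ^ 2"
      "fy x2 y2 - fy x1 y1 = ((y2 - y1) - s * (x2 - x1)) / u ^ 3"
      by (simp_all add: fx_def fy_def algebra_simps flip: diff_divide_distrib add_divide_distrib)
    ultimately show ?thesis
      unfolding l_def slope_def fx_eq using False u
      by (simp add: power_numeral_reduce) (simp add: field_simps)
  qed
  define x3 where "x3 = l ^ 2 + a1 W * l - a2 W - x1 - x2"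
  have x3: "((l - s) / u) ^ 2 + a1 ?C * ((l - s) / u) - a2 ?C - fx x1 - fx x2 = fx x3"
    using u by (simp add: x3_def fx_def change_curve_def field_simps power_numeral_reduce)
  show ?thesis
    unfolding P Q ec_add_affine[OF ninf l_def[symmetric] x3_def[symmetric]]
    unfolding fP[unfolded P] fQ[unfolded Q] ec_add_affine[OF ninf' l' x3]
    using u by (simp add: fx_def fy_def change_curve_def) (simp add: field_simps power_numeral_reduce)
qed

section \<open>Galois action on points\<close>

lemma absolute_galois_iff: "\<sigma> \<in> absolute_galois \<longleftrightarrow> automorphism_over_base \<sigma>"
  by (simp add: absolute_galois_def automorphism_over_base_def)

context
  fixes \<sigma> :: "'k::field alg_closure \<Rightarrow> 'k alg_closure"
  assumes \<sigma>: "automorphism_over_base \<sigma>"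
begin

lemma automorphism_base: "\<sigma> (to_ac q) = to_ac q"
  and automorphism_add: "\<sigma> (x + y) = \<sigma> x + \<sigma> y"
  and automorphism_mult: "\<sigma> (x * y) = \<sigma> x * \<sigma> y"
  using \<sigma> by (simp_all add: automorphism_over_base_def)

lemma automorphism_minus: "\<sigma> (- x) = - \<sigma> x"
  using automorphism_mult[of "to_ac (- 1)" x] automorphism_base[of "- 1"] by simp

lemma automorphism_diff: "\<sigma> (x - y) = \<sigma> x - \<sigma> y"
  using automorphism_add[of x "- y"] automorphism_minus[of y] by simp

lemma automorphism_power: "\<sigma> (x ^ n) = \<sigma> x ^ n"
  using automorphism_base[of 1] by (induction n) (simp_all add: automorphism_mult)

lemma automorphism_divide_base: "\<sigma> (x / to_ac q) = \<sigma> x / to_ac q"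
  using automorphism_mult[of x "to_ac (inverse q)"] automorphism_base[of "inverse q"]
  by (simp add: divide_inverse)

lemmas automorphism_simps = automorphism_base automorphism_add automorphism_mult
  automorphism_minus automorphism_diff automorphism_power automorphism_divide_base

lemma inj_map_automorphism: "inj (map_ec_point \<sigma>)"
  using \<sigma> by (simp add: automorphism_over_base_def bij_is_inj ec_point.inj_map)

lemma map_automorphism_neg:
  "map_ec_point \<sigma> (ec_neg (map_weierstrass to_ac W) P) = ec_neg (map_weierstrass to_ac W) (map_ec_point \<sigma> P)"
  by (cases P; cases W) (simp_all add: automorphism_simps)

lemma on_curve_map_automorphism:
  assumes "on_curve (map_weierstrass to_ac W) P"
  shows "on_curve (map_weierstrass to_ac W) (map_ec_point \<sigma> P)"
proof (cases P)
  case (Affine x y)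
  obtain c1 c2 c3 c4 c6 where W: "W = Weierstrass c1 c2 c3 c4 c6"
    by (cases W)
  have "\<sigma> (y ^ 2 + to_ac c1 * x * y + to_ac c3 * y) = \<sigma> (x ^ 3 + to_ac c2 * x ^ 2 + to_ac c4 * x + to_ac c6)"
    using assms by (simp add: Affine W)
  then show ?thesis
    by (simp add: Affine W automorphism_simps)
qed simp

lemma map_automorphism_change_point:
  "change_point (to_ac u) (to_ac r) (to_ac s) (to_ac t) (map_ec_point \<sigma> P) =
    map_ec_point \<sigma> (change_point (to_ac u) (to_ac r) (to_ac s) (to_ac t) P)"
  by (cases P) (simp_all add: automorphism_simps flip: to_ac_power)

end

text \<open>
  For finite sets inclusion suffices, as automorphisms act injectively on points.
\<close>

lemma galois_stableI:
  assumes "finite H" "\<And>\<sigma>. \<sigma> \<in> absolute_galois \<Longrightarrow> map_ec_point \<sigma> ` H \<subseteq> H"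
  shows "galois_stable H"
  unfolding galois_stable_def
proof
  fix \<sigma> assume "\<sigma> \<in> absolute_galois"
  then show "map_ec_point \<sigma> ` H = H"
    using assms inj_map_automorphism[of \<sigma>]
    by (intro endo_inj_surj) (auto simp: absolute_galois_iff intro: inj_on_subset)
qed

section \<open>Halving the origin on a curve with a point of order two at the origin\<close>

text \<open>
  The equation \<open>y\<^sup>2 = x (x\<^sup>2 + g x + D)\<close>. Leaving \<open>D\<close> arbitrary allows the halving formula to
  be used in the construction of the model, where \<open>D\<close> is only found to be a square afterwards.
\<close>

abbreviation two_torsion_form :: "'a::zero \<Rightarrow> 'a \<Rightarrow> 'a weierstrass" where
  "two_torsion_form g D \<equiv> Weierstrass 0 g 0 D 0"

text \<open>
  With \<open>m = 3 x\<^sup>2 + 2 g x + D\<close>, so that the tangent has slope \<open>m / (2 y)\<close>, the condition that the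
  double has \<open>x\<close>-coordinate 0 reads \<open>m\<^sup>2 = 4 (g + 2 x) y\<^sup>2\<close>. On the curve the difference of the
  two sides is \<open>(x\<^sup>2 - D)\<^sup>2\<close>.
\<close>

lemma x_of_half_of_origin:
  fixes g D x y :: "'a::field"
  assumes on: "on_curve (two_torsion_form g D) (Affine x y)"
    and double: "ec_add (two_torsion_form g D) (Affine x y) (Affine x y) = Affine 0 0"
  shows "x ^ 2 = D"
proof -
  let ?N = "two_torsion_form g D"
  have neq: "ec_neg ?N (Affine x y) \<noteq> Affine x y"
    using double by (metis ec_add_eq_Infinity_iff ec_point.distinct(1))
  then have y: "2 * y \<noteq> 0"
    unfolding ec_neg_Affine_eq_iff by simp
  define m where "m = 3 * x ^ 2 + 2 * g * x + D"
  have "slope ?N x y x y = m / (2 * y)"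
    by (simp add: slope_def m_def)
  from ec_add_affine[OF neq this refl] double have l2: "(m / (2 * y)) ^ 2 = g + x + x"
    by (simp add: algebra_simps)
  have "m ^ 2 = (m / (2 * y) * (2 * y)) ^ 2"
    using y by simp
  also have "\<dots> = (g + x + x) * (4 * y ^ 2)"
    unfolding power_mult_distrib l2 by simp
  also have "y ^ 2 = x ^ 3 + g * x ^ 2 + D * x"
    using on by simp
  finally have "(x ^ 2 - D) ^ 2 = 0"
    unfolding m_def by (simp add: algebra_simps power_numeral_reduce)
  then show ?thesis by simp
qed

text \<open>
  If \<open>x\<^sup>2 = D\<close> then \<open>y\<^sup>2 = x\<^sup>2 (g + 2 x)\<close>, which is nonzero as \<open>g + 2 x\<close> divides
  \<open>g\<^sup>2 - 4 D\<close>. The tangent at \<open>(x, y)\<close> passes through the origin: both it and the chord to the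
  origin have slope \<open>y / x\<close>. So one line computes all three sums.
\<close>

lemma half_of_origin_table:
  fixes g D x y :: "'a::field"
  assumes two: "(2::'a) \<noteq> 0" and on: "on_curve (two_torsion_form g D) (Affine x y)"
    and x: "x ^ 2 = D" and D: "D \<noteq> 0" "g ^ 2 - 4 * D \<noteq> 0"
  shows "ec_add (two_torsion_form g D) (Affine x y) (Affine x y) = Affine 0 0"
    and "ec_add (two_torsion_form g D) (Affine x y) (Affine 0 0) = Affine x (- y)"
    and "ec_add (two_torsion_form g D) (Affine 0 0) (Affine x y) = Affine x (- y)"
proof -
  let ?N = "two_torsion_form g D"
  have "x \<noteq> 0" using x D by auto
  have y2: "y ^ 2 = x ^ 2 * (g + 2 * x)"
    using on by (simp add: x[symmetric] algebra_simps power_numeral_reduce)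
  have "(g + 2 * x) * (g - 2 * x) = g ^ 2 - 4 * D"
    by (simp add: x[symmetric] algebra_simps power_numeral_reduce)
  then have "g + 2 * x \<noteq> 0"
    using D by auto
  then have "y \<noteq> 0"
    using y2 \<open>x \<noteq> 0\<close> by auto
  have "slope ?N x y x y = (x * (2 * (g + 2 * x))) / (2 * y)"
    by (simp add: slope_def x[symmetric] algebra_simps power_numeral_reduce)
  also have "x * (2 * a) / (2 * y) = x * a / y" for a
    using two by simp
  also have "x * (g + 2 * x) / y = y / x"
    using y2 \<open>x \<noteq> 0\<close> \<open>y \<noteq> 0\<close> by (simp add: field_simps power2_eq_square)
  finally have l: "slope ?N x y x y = y / x" .
  have l2: "(y / x) ^ 2 = g + 2 * x"
    using y2 \<open>x \<noteq> 0\<close> by (simp add: power_divide)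
  have "ec_neg ?N (Affine x y) \<noteq> Affine x y"
    unfolding ec_neg_Affine_eq_iff using two \<open>y \<noteq> 0\<close> by (simp flip: mult_2)
  from ec_add_affine[OF this l refl] show "ec_add ?N (Affine x y) (Affine x y) = Affine 0 0"
    using \<open>x \<noteq> 0\<close> by (simp add: l2)
  have "ec_neg ?N (Affine x y) \<noteq> Affine 0 0" "slope ?N x y 0 0 = y / x"
    using \<open>x \<noteq> 0\<close> by (simp_all add: slope_def)
  from ec_add_affine[OF this refl] show "ec_add ?N (Affine x y) (Affine 0 0) = Affine x (- y)"
    using \<open>x \<noteq> 0\<close> by (simp add: l2)
  have "ec_neg ?N (Affine 0 0) \<noteq> Affine x y" "slope ?N 0 0 x y = y / x"
    using \<open>x \<noteq> 0\<close> by (simp_all add: slope_def)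
  from ec_add_affine[OF this refl] show "ec_add ?N (Affine 0 0) (Affine x y) = Affine x (- y)"
    using \<open>x \<noteq> 0\<close> by (simp add: l2)
qed

text \<open>
  Infinity, the origin and all points of the curve above \<open>x\<close>. Not choosing one of the two points
  above \<open>x\<close> makes the set visibly invariant under automorphisms that fix \<open>g\<close>, \<open>D\<close> and \<open>x\<close>.
\<close>

definition fibre_quadruple :: "'a::field \<Rightarrow> 'a \<Rightarrow> 'a \<Rightarrow> 'a ec_point set" where
  "fibre_quadruple g D x =
     {Infinity, Affine 0 0} \<union> {Affine x y | y. on_curve (two_torsion_form g D) (Affine x y)}"

lemma fibre_quadruple_eq:
  assumes "on_curve (two_torsion_form g D) (Affine x y)"
  shows "fibre_quadruple g D x =
    {Infinity, Affine x y, Affine 0 0, ec_neg (two_torsion_form g D) (Affine x y)}"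
  using assms on_curve_same_x[OF assms] by (auto simp: fibre_quadruple_def)

lemma curve_point_exists:
  fixes g D x :: "'a::alg_closed_field"
  obtains y where "on_curve (two_torsion_form g D) (Affine x y)"
  using nth_root_exists[of 2 "x ^ 3 + g * x ^ 2 + D * x"] by auto

text \<open>
  There is a point above every \<open>x\<close>; the condition \<open>x \<noteq> 0\<close> distinguishes it from the origin, which
  lies in every quadruple.
\<close>

lemma fibre_quadruple_inj:
  fixes g D x :: "'a::alg_closed_field"
  assumes "fibre_quadruple g D x = fibre_quadruple g D x'" "x \<noteq> 0"
  shows "x = x'"
proof -
  obtain y where "on_curve (two_torsion_form g D) (Affine x y)"
    by (rule curve_point_exists)
  then have "Affine x y \<in> fibre_quadruple g D x"
    by (simp add: fibre_quadruple_def)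
  then have "Affine x y \<in> fibre_quadruple g D x'"
    unfolding assms(1) .
  then show ?thesis
    using assms(2) by (auto simp: fibre_quadruple_def)
qed

lemma fibre_quadruple_Int:
  assumes "x \<noteq> x'"
  shows "fibre_quadruple g D x \<inter> fibre_quadruple g D x' = {Infinity, Affine 0 0}"
  using assms by (auto simp: fibre_quadruple_def)

section \<open>Stable cyclic subgroups of order four over the origin\<close>

lemma map_weierstrass_change_curve:
  "map_weierstrass to_ac (change_curve u r s t W) =
    change_curve (to_ac u) (to_ac r) (to_ac s) (to_ac t) (map_weierstrass to_ac W)"
  by (cases W) (simp add: change_curve_def)

context
  fixes E :: "rat weierstrass" and g d u r s t :: rat
  assumes u: "u \<noteq> 0" and d: "d \<noteq> 0" and nonsingular: "g ^ 2 - 4 * d ^ 2 \<noteq> 0"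
    and model: "change_curve u r s t E = normal_form g d"
begin

private abbreviation (input) "W \<equiv> map_weierstrass to_ac E"
private abbreviation (input) "N \<equiv> two_torsion_form (to_ac g) (to_ac d ^ 2)"
private abbreviation (input) "\<phi> \<equiv> to_model u r s t"
private abbreviation (input) "quadruple \<equiv> fibre_quadruple (to_ac g) (to_ac d ^ 2)"

lemma model_facts:
  shows to_model_add: "on_curve W P \<Longrightarrow> on_curve W Q \<Longrightarrow> \<phi> (ec_add W P Q) = ec_add N (\<phi> P) (\<phi> Q)"
    and to_model_neg: "\<phi> (ec_neg W P) = ec_neg N (\<phi> P)"
    and on_curve_to_model: "on_curve N (\<phi> P) \<longleftrightarrow> on_curve W P"
    and to_model_eq_iff: "\<phi> P = \<phi> Q \<longleftrightarrow> P = Q"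
    and surj_to_model: "surj \<phi>"
proof -
  have N: "change_curve (to_ac u) (to_ac r) (to_ac s) (to_ac t) W = N"
    using map_weierstrass_change_curve[of u r s t E] by (simp add: model normal_form_def)
  have u': "to_ac u \<noteq> 0" using u by simp
  show "\<phi> (ec_add W P Q) = ec_add N (\<phi> P) (\<phi> Q)" if "on_curve W P" "on_curve W Q"
    unfolding N[symmetric] using u' that by (rule change_point_add)
  show "\<phi> (ec_neg W P) = ec_neg N (\<phi> P)"
    unfolding N[symmetric] using u' by (rule change_point_neg)
  show "on_curve N (\<phi> P) \<longleftrightarrow> on_curve W P"
    unfolding N[symmetric] using u' by (rule on_curve_change)
  show "\<phi> P = \<phi> Q \<longleftrightarrow> P = Q"
    using inj_change_point[OF u'] by (rule inj_eq)
  show "surj \<phi>"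
    using u' by (rule surj_change_point)
qed

lemma to_model_Infinity: "\<phi> P = Infinity \<longleftrightarrow> P = Infinity"
  by (cases P) simp_all

lemma preimage_image: "\<phi> -` (\<phi> ` H) = H"
  by (auto simp: to_model_eq_iff)

text \<open>
  In the model the origin is its own negative, so it is the unique element of order two of the group
  and equals \<open>2P\<close> for every generator \<open>P\<close>. The halving formula leaves two values for the
  \<open>x\<close>-coordinate of \<open>P\<close>, and this value determines the group.
\<close>

lemma cyclic_4_over_origin:
  assumes H: "cyclic_subgroup (geometric_points E) 4 H" and origin: "Affine 0 0 \<in> \<phi> ` H"
  obtains x where "x = to_ac d \<or> x = - to_ac d" "H = \<phi> -` quadruple x"
    "\<And>P. generates (geometric_points E) H P \<Longrightarrow> (\<exists>y. \<phi> P = Affine x y) \<and> \<phi> (ec_add W P P) = Affine 0 0"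
proof -
  have sub: "subgroup H (ec_group W)" and card: "card H = 4"
    using H by (auto simp: cyclic_subgroup_def geometric_points_def)
  have gen: "\<exists>x y. \<phi> P = Affine x y \<and> (x = to_ac d \<or> x = - to_ac d) \<and> H = \<phi> -` quadruple x \<and>
      \<phi> (ec_add W P P) = Affine 0 0" if P: "generates (ec_group W) H P" for P
  proof -
    note gen = generator_of_cyclic_4[OF sub card P]
    have on: "on_curve W P"
      using sub P by (auto simp: generates_def subgroup_ec_group_iff)
    obtain S where S: "S \<in> H" "\<phi> S = Affine 0 0"
      using origin by auto
    \<comment> \<open>The origin is its own negative, hence it is the element of order two.\<close>
    have "ec_neg N (\<phi> S) = \<phi> S"
      by (simp add: S(2))
    then have "ec_neg W S = S"
      by (simp add: to_model_eq_iff flip: to_model_neg)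
    moreover have "S \<noteq> Infinity"
      using S(2) by auto
    ultimately have "S \<in> order_two_points (ec_group W) H"
      using S(1) by (simp add: order_two_points_ec_group)
    then have T: "\<phi> (ec_add W P P) = Affine 0 0"
      using S(2) by (simp add: order_two_points_cyclic_4[OF sub card P])
    have "P \<noteq> Infinity"
      using gen(2) by auto
    then obtain x y where xy: "\<phi> P = Affine x y"
      by (metis to_model_Infinity ec_point.exhaust)
    have onN: "on_curve N (Affine x y)"
      using on on_curve_to_model[of P] xy by metis
    have "x ^ 2 = to_ac d ^ 2"
      by (rule x_of_half_of_origin[OF onN]) (use to_model_add[OF on on] T xy in metis)
    then have "x = to_ac d \<or> x = - to_ac d"
      by (simp add: power2_eq_iff)
    moreover have "\<phi> ` H = quadruple x"
      unfolding fibre_quadruple_eq[OF onN] by (subst gen(1)) (simp only: image_insert image_empty T xy to_model_neg change_point.simps)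
    then have "H = \<phi> -` quadruple x"
      using preimage_image[of H] by simp
    ultimately show ?thesis
      using xy T by blast
  qed
  obtain P where "generates (ec_group W) H P"
    using H by (auto simp: cyclic_subgroup_def geometric_points_def)
  from gen[OF this] obtain x y where x: "x = to_ac d \<or> x = - to_ac d" "H = \<phi> -` quadruple x"
    by blast
  have nz: "x' \<noteq> 0" if "x' = to_ac d \<or> x' = - to_ac d" for x'
    using that d by auto
  have inj: "x' = x" if "H = \<phi> -` quadruple x'" "x' = to_ac d \<or> x' = - to_ac d" for x'
  proof -
    have "quadruple x' = quadruple x"
      using that(1) x(2) surj_image_vimage_eq[OF surj_to_model] by metis
    then show ?thesis
      using fibre_quadruple_inj nz[OF that(2)] by blast
  qed
  show thesis
  proof (rule that[OF x])
    fix P assume "generates (geometric_points E) H P"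
    then show "(\<exists>y. \<phi> P = Affine x y) \<and> \<phi> (ec_add W P P) = Affine 0 0"
      using gen[of P] inj unfolding geometric_points_def by blast
  qed
qed

text \<open>
  Both solutions of \<open>x\<^sup>2 = \<delta>\<^sup>2\<close> are rational, so the corresponding quadruples are mapped to
  themselves by Galois, even though the points above \<open>x\<close> may be interchanged.
\<close>

lemma stable_cyclic4_fibre:
  assumes e: "e = d \<or> e = - d"
  shows "stable_cyclic4 E (\<phi> -` quadruple (to_ac e))"
proof -
  define x where "x = to_ac e"
  have x2: "x ^ 2 = to_ac d ^ 2"
    using e by (auto simp: x_def)
  have D: "to_ac d ^ 2 \<noteq> 0" and nz: "to_ac g ^ 2 - 4 * to_ac d ^ 2 \<noteq> 0"
  proof -
    show "to_ac d ^ 2 \<noteq> 0" using d by simp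
    have "to_ac (g ^ 2 - 4 * d ^ 2) \<noteq> 0"
      using nonsingular by (simp only: to_ac_eq_0_iff not_False_eq_True)
    then show "to_ac g ^ 2 - 4 * to_ac d ^ 2 \<noteq> 0"
      by (simp only: to_ac_diff to_ac_mult to_ac_power to_ac_numeral not_False_eq_True)
  qed
  obtain y where onN: "on_curve N (Affine x y)"
    by (rule curve_point_exists)
  then have onN': "on_curve N (Affine x (- y))"
    by simp
  have two: "(2 :: qbar) \<noteq> 0" by simp
  note table = half_of_origin_table[OF two onN x2 D nz] half_of_origin_table[OF two onN' x2 D nz]
  obtain P where P: "\<phi> P = Affine x y"
    using surj_to_model by (metis surjD)
  obtain T where T: "\<phi> T = Affine 0 0"
    using surj_to_model by (metis surjD)
  have neg: "ec_neg N (Affine x y) = Affine x (- y)" by simp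
  have on: "on_curve W P" "on_curve W T" "on_curve W (ec_neg W P)"
    using on_curve_to_model[of P] on_curve_to_model[of T] onN P T by auto
  have eqI: "S = S'" if "\<phi> S = \<phi> S'" for S S'
    using that by (simp add: to_model_eq_iff)
  have "cyclic_subgroup (ec_group W) 4 {Infinity, P, T, ec_neg W P}"
  proof (rule cyclic_4_of_table)
    show "T \<noteq> Infinity" using T by auto
    show "ec_neg W T = T"
      by (rule eqI) (simp add: to_model_neg T)
    show "ec_add W P P = T"
      by (rule eqI) (simp only: to_model_add on P T table)
    show "ec_add W P T = ec_neg W P"
      by (rule eqI) (simp only: to_model_add to_model_neg on P T table neg)
    show "ec_add W T P = ec_neg W P"
      by (rule eqI) (simp only: to_model_add to_model_neg on P T table neg)
    show "ec_add W (ec_neg W P) T = P"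
      by (rule eqI) (simp only: to_model_add to_model_neg on P T table neg minus_minus)
    show "ec_add W T (ec_neg W P) = P"
      by (rule eqI) (simp only: to_model_add to_model_neg on P T table neg minus_minus)
  qed (use on in simp_all)
  moreover have "\<phi> ` {Infinity, P, T, ec_neg W P} = quadruple x"
    unfolding fibre_quadruple_eq[OF onN] by (simp only: image_insert image_empty T P to_model_neg change_point.simps)
  ultimately have cyclic: "cyclic_subgroup (geometric_points E) 4 (\<phi> -` quadruple x)"
    using preimage_image geometric_points_def by metis
  moreover have "galois_stable (\<phi> -` quadruple x)"
  proof (rule galois_stableI)
    show "finite (\<phi> -` quadruple x)"
      using cyclic by (intro card_ge_0_finite) (simp add: cyclic_subgroup_def)
  next
    fix \<sigma> :: "qbar \<Rightarrow> qbar" assume "\<sigma> \<in> absolute_galois"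
    then have \<sigma>: "automorphism_over_base \<sigma>"
      by (simp add: absolute_galois_iff)
    have "map_ec_point \<sigma> S \<in> quadruple x" if S: "S \<in> quadruple x" for S
    proof (cases "S \<in> {Infinity, Affine 0 0}")
      case True
      then show ?thesis
        using automorphism_base[OF \<sigma>, of 0] by (auto simp: fibre_quadruple_def)
    next
      case False
      then obtain z where z: "S = Affine x z" "on_curve N S"
        using S unfolding fibre_quadruple_def by blast
      have "N = map_weierstrass to_ac (normal_form g d)"
        by (simp add: normal_form_def)
      then have "on_curve N (map_ec_point \<sigma> S)"
        using on_curve_map_automorphism[OF \<sigma>] z(2) by metis
      moreover have "map_ec_point \<sigma> S = Affine x (\<sigma> z)"
        by (simp add: z(1) x_def automorphism_base[OF \<sigma>])
      ultimately show ?thesis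
        by (simp add: fibre_quadruple_def)
    qed
    then show "map_ec_point \<sigma> ` (\<phi> -` quadruple x) \<subseteq> \<phi> -` quadruple x"
      by (auto simp: map_automorphism_change_point[OF \<sigma>])
  qed
  ultimately show ?thesis
    by (simp add: stable_cyclic4_def x_def)
qed

end

section \<open>Existence of an adapted model\<close>

text \<open>
  The change of variables is inverted, so that the coefficients of \<open>E\<close> become polynomials in
  \<open>r\<close>, \<open>s\<close>, \<open>t\<close>, \<open>g\<close> and \<open>D\<close>. The auxiliary quantities \<open>b2\<close>, ..., \<open>b8\<close> of the discriminant
  no longer involve \<open>s\<close> and \<open>t\<close>, which keeps the final expansion small.
\<close>

lemma discriminant_two_torsion_model:
  fixes E :: "'a::field weierstrass"
  assumes "change_curve 1 r s t E = two_torsion_form g D"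
  shows "discriminant E = 16 * D ^ 2 * (g ^ 2 - 4 * D)"
proof -
  have a: "a1 E = - 2 * s" "a2 E = g + s * a1 E - 3 * r + s ^ 2" "a3 E = - r * a1 E - 2 * t"
    "a4 E = D + s * a3 E - 2 * r * a2 E + (t + r * s) * a1 E - 3 * r ^ 2 + 2 * s * t"
    "a6 E = - r * a4 E - r ^ 2 * a2 E - r ^ 3 + t * a3 E + t ^ 2 + r * t * a1 E"
    using assms by (auto simp: change_curve_def algebra_simps eq_neg_iff_add_eq_0)
  define b2 where "b2 = a1 E ^ 2 + 4 * a2 E"
  define b4 where "b4 = 2 * a4 E + a1 E * a3 E"
  define b6 where "b6 = a3 E ^ 2 + 4 * a6 E"
  define b8 where "b8 = a1 E ^ 2 * a6 E + 4 * a2 E * a6 E - a1 E * a3 E * a4 E + a2 E * a3 E ^ 2 - a4 E ^ 2"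
  have b: "b2 = 4 * g - 12 * r" "b4 = 2 * D - 4 * r * g + 6 * r ^ 2"
      "b6 = - 4 * r * D + 4 * r ^ 2 * g - 4 * r ^ 3"
      "b8 = 6 * r ^ 2 * D - 4 * r ^ 3 * g + 3 * r ^ 4 - D ^ 2"
    unfolding b2_def b4_def b6_def b8_def a
    by (simp_all add: algebra_simps power_numeral_reduce)
  have "discriminant E = - (b2 ^ 2 * b8) - 8 * b4 ^ 3 - 27 * b6 ^ 2 + 9 * b2 * b4 * b6"
    by (simp add: discriminant_def Let_def b2_def b4_def b6_def b8_def)
  then show ?thesis
    unfolding b by (simp add: algebra_simps power_numeral_reduce)
qed

text \<open>
  Galois permutes the elements of \<open>G\<close> and commutes with negation. So it fixes the only element of order
  two and maps a generator to itself or to its negative, which has the same \<open>x\<close>-coordinate.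
\<close>

lemma stable_generator_rational:
  assumes "stable_cyclic4 E G"
  obtains r t p y where "generates (geometric_points E) G (Affine (to_ac p) y)"
    "ec_add (map_weierstrass to_ac E) (Affine (to_ac p) y) (Affine (to_ac p) y) = Affine (to_ac r) (to_ac t)"
proof -
  let ?W = "map_weierstrass to_ac E"
  have sub: "subgroup G (ec_group ?W)" and card: "card G = 4" and stable: "galois_stable G"
    using assms by (auto simp: stable_cyclic4_def cyclic_subgroup_def geometric_points_def)
  obtain P where P: "generates (ec_group ?W) G P"
    using assms by (auto simp: stable_cyclic4_def cyclic_subgroup_def geometric_points_def)
  note gen = generator_of_cyclic_4[OF sub card P]
  obtain x y where xy: "P = Affine x y"
    using gen(2) by (cases P) auto
  obtain a b where T: "ec_add ?W P P = Affine a b"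
    using gen(3) by (cases "ec_add ?W P P") auto
  have fixed: "\<sigma> x = x \<and> \<sigma> a = a \<and> \<sigma> b = b" if \<sigma>: "automorphism_over_base \<sigma>" for \<sigma>
  proof -
    have im: "map_ec_point \<sigma> S \<in> G" if "S \<in> G" for S
      using stable \<sigma> that unfolding galois_stable_def absolute_galois_iff[symmetric] by blast
    note neg = map_automorphism_neg[OF \<sigma>, of E]
    have "ec_neg ?W (Affine a b) = Affine a b"
      using gen(4) unfolding T .
    then have "ec_neg ?W (map_ec_point \<sigma> (Affine a b)) = map_ec_point \<sigma> (Affine a b)"
      by (simp only: flip: neg)
    moreover have "map_ec_point \<sigma> (Affine a b) \<in> G"
      by (rule im, subst gen(1)) (simp add: T)
    moreover have "map_ec_point \<sigma> (Affine a b) \<noteq> Infinity"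
      by simp
    ultimately have "map_ec_point \<sigma> (Affine a b) \<in> order_two_points (ec_group ?W) G"
      unfolding order_two_points_ec_group by blast
    then have "map_ec_point \<sigma> (Affine a b) = Affine a b"
      unfolding order_two_points_cyclic_4[OF sub card P] T by simp
    moreover have "ec_neg ?W (map_ec_point \<sigma> P) \<noteq> map_ec_point \<sigma> P"
      using gen(2) inj_map_automorphism[OF \<sigma>] neg[of P] by (metis injD)
    then have "map_ec_point \<sigma> P \<in> {P, ec_neg ?W P}"
      using im[of P] gen by auto
    ultimately show ?thesis
      unfolding xy by auto
  qed
  obtain p where p: "x = to_ac p"
    using fixed_by_automorphisms_imp_base[of x] fixed by blast
  obtain r where r: "a = to_ac r"
    using fixed_by_automorphisms_imp_base[of a] fixed by blast
  obtain t where t: "b = to_ac t"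
    using fixed_by_automorphisms_imp_base[of b] fixed by blast
  show thesis
    using that P T unfolding xy p r t geometric_points_def by blast
qed

text \<open>
  The translation by the rational point of order two \<open>(r, t)\<close>, together with \<open>s = - a\<^sub>1 / 2\<close> to remove the
  \<open>x y\<close> term, leads to the form \<open>y\<^sup>2 = x (x\<^sup>2 + g x + D)\<close>. There \<open>D\<close> is the square of the
  \<open>x\<close>-coordinate \<open>p - r\<close> of the generator, and the discriminant gives the two nonvanishing
  conditions.
\<close>

lemma adapted_model_exists:
  assumes "elliptic E" and G: "stable_cyclic4 E G"
  shows "\<exists>g d u r s t. adapted_model E G g d u r s t"
proof -
  let ?W = "map_weierstrass to_ac E"
  obtain r t p y where gen: "generates (geometric_points E) G (Affine (to_ac p) y)"
    and double: "ec_add ?W (Affine (to_ac p) y) (Affine (to_ac p) y) = Affine (to_ac r) (to_ac t)"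
    using stable_generator_rational[OF G] by metis
  have sub: "subgroup G (ec_group ?W)" and card: "card G = 4"
    using G by (auto simp: stable_cyclic4_def cyclic_subgroup_def geometric_points_def)
  note gen = gen[unfolded geometric_points_def]
  note facts = generator_of_cyclic_4[OF sub card gen, unfolded double]
  have on: "on_curve ?W (Affine (to_ac p) y)" "on_curve ?W (Affine (to_ac r) (to_ac t))"
    using sub facts(1) by (auto simp: subgroup_ec_group_iff)
  obtain c1 c2 c3 c4 c6 where E: "E = Weierstrass c1 c2 c3 c4 c6"
    by (cases E)
  have T: "t ^ 2 + c1 * r * t + c3 * t = r ^ 3 + c2 * r ^ 2 + c4 * r + c6"
    using on(2) by (simp add: E flip: to_ac_add to_ac_mult to_ac_power)
  have T2: "t + t + c1 * r + c3 = 0"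
    using facts(4) unfolding ec_neg_Affine_eq_iff by (simp add: E flip: to_ac_add to_ac_mult)
  \<comment> \<open>This choice makes the new coefficient of \<open>x y\<close> vanish.\<close>
  define s where "s = - c1 / 2"
  define g where "g = a2 (change_curve 1 r s t E)"
  define D where "D = a4 (change_curve 1 r s t E)"
  have "c6 + r * c4 + r ^ 2 * c2 + r ^ 3 - t * c3 - t ^ 2 - r * t * c1 = 0"
    using T by (simp add: algebra_simps)
  moreover have "c3 + r * c1 + 2 * t = 0"
    using T2 by (simp add: algebra_simps)
  ultimately have model: "change_curve 1 r s t E = two_torsion_form g D"
    by (simp add: g_def D_def s_def E change_curve_def)
  let ?f = "to_model 1 r s t"
  have N: "change_curve (to_ac 1) (to_ac r) (to_ac s) (to_ac t) ?W = two_torsion_form (to_ac g) (to_ac D)"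
    using map_weierstrass_change_curve[of 1 r s t E] unfolding model by simp
  have one: "to_ac 1 \<noteq> (0 :: qbar)" by simp
  obtain z where z: "?f (Affine (to_ac p) y) = Affine (to_ac (p - r)) z"
    by simp
  have origin: "?f (Affine (to_ac r) (to_ac t)) = Affine 0 0"
    by simp
  have "ec_add (two_torsion_form (to_ac g) (to_ac D)) (Affine (to_ac (p - r)) z) (Affine (to_ac (p - r)) z) = Affine 0 0"
    using change_point_add[OF one on(1) on(1), of "to_ac r" "to_ac s" "to_ac t"] unfolding N double z origin by simp
  moreover have "on_curve (two_torsion_form (to_ac g) (to_ac D)) (Affine (to_ac (p - r)) z)"
    using on_curve_change[OF one, of "to_ac r" "to_ac s" "to_ac t" ?W] on(1) unfolding N z[symmetric] by blast
  ultimately have "to_ac (p - r) ^ 2 = to_ac D"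
    using x_of_half_of_origin by blast
  then have D: "D = (p - r) ^ 2"
    by (simp only: to_ac_eq_iff flip: to_ac_power)
  have "discriminant E \<noteq> 0"
    using assms(1) by (simp add: elliptic_def)
  then have "p - r \<noteq> 0" "g ^ 2 - 4 * (p - r) ^ 2 \<noteq> 0"
    unfolding discriminant_two_torsion_model[OF model] D by auto
  moreover have "change_curve 1 r s t E = normal_form g (p - r)"
    by (simp add: model normal_form_def D)
  moreover have "?f ` order_two_points (geometric_points E) G = {Affine 0 0}"
    unfolding geometric_points_def order_two_points_cyclic_4[OF sub card gen] double
    by (simp only: image_insert image_empty origin)
  ultimately have "adapted_model E G g (p - r) 1 r s t"
    by (simp add: adapted_model_def)
  then show ?thesis by blast
qed

section \<open>The pairing of the stable cyclic subgroups\<close>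

theorem corollary3p3:
  fixes E :: "rat weierstrass" and G :: "qbar ec_point set"
  assumes "elliptic E" and "stable_cyclic4 E G"
  shows "(\<exists>\<gamma> \<delta> u r s t. adapted_model E G \<gamma> \<delta> u r s t) \<and>
    (\<forall>\<gamma> \<delta> u r s t. adapted_model E G \<gamma> \<delta> u r s t \<longrightarrow>
      (\<exists>!G'. stable_cyclic4 E G' \<and> G' \<noteq> G \<and> Affine 0 0 \<in> to_model u r s t ` G') \<and>
      (\<forall>G'. stable_cyclic4 E G' \<and> G' \<noteq> G \<and> Affine 0 0 \<in> to_model u r s t ` G' \<longrightarrow>
        (\<exists>\<xi>. (\<forall>P. generates (geometric_points E) G P \<longrightarrow>
                  (\<exists>y. to_model u r s t P = Affine \<xi> y)) \<and>
             (\<forall>Q. generates (geometric_points E) G' Q \<longrightarrow>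
                  (\<exists>y. to_model u r s t Q = Affine (- \<xi>) y))) \<and>
        order_two_subgroups (geometric_points E) G = {G \<inter> G'} \<and>
        order_two_subgroups (geometric_points E) G' = {G \<inter> G'} \<and>
        (\<forall>T. generates (geometric_points E) (G \<inter> G') T \<longrightarrow> rational_point T)))"
proof (intro conjI allI impI)
  show "\<exists>\<gamma> \<delta> u r s t. adapted_model E G \<gamma> \<delta> u r s t"
    using assms by (rule adapted_model_exists)
next
  fix \<gamma> \<delta> u r s t
  assume "adapted_model E G \<gamma> \<delta> u r s t"
  then have d: "\<delta> \<noteq> 0" and nz: "\<gamma> ^ 2 - 4 * \<delta> ^ 2 \<noteq> 0" and u: "u \<noteq> 0"
    and model: "change_curve u r s t E = normal_form \<gamma> \<delta>"
    and two: "to_model u r s t ` order_two_points (geometric_points E) G = {Affine 0 0}"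
    by (simp_all add: adapted_model_def)
  note ctx = u d nz model
  let ?W = "map_weierstrass to_ac E" and ?f = "to_model u r s t"
  let ?Q = "fibre_quadruple (to_ac \<gamma>) (to_ac \<delta> ^ 2)"
  have originG: "Affine 0 0 \<in> ?f ` G"
    using two by (auto simp: order_two_points_def)
  have cyclicG: "cyclic_subgroup (geometric_points E) 4 G"
    using assms(2) by (simp add: stable_cyclic4_def)
  obtain x where x: "x = to_ac \<delta> \<or> x = - to_ac \<delta>" "G = ?f -` ?Q x"
    and genG: "\<And>P. generates (geometric_points E) G P \<Longrightarrow>
      (\<exists>y. ?f P = Affine x y) \<and> ?f (ec_add ?W P P) = Affine 0 0"
    by (rule cyclic_4_over_origin[OF ctx cyclicG originG]) blast
  have "x \<noteq> 0" using x(1) d by auto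
  have x_neq: "- x \<noteq> x"
    using \<open>x \<noteq> 0\<close> by simp
  have preimage_inj: "A = B" if "?f -` A = ?f -` B" for A B
    using that surj_image_vimage_eq[OF surj_to_model[OF ctx]] by metis
  have origin_mem: "Affine 0 0 \<in> ?f ` (?f -` ?Q z)" for z
    unfolding surj_image_vimage_eq[OF surj_to_model[OF ctx]] by (simp add: fibre_quadruple_def)
  \<comment> \<open>Any other such group belongs to the solution of \<open>x\<^sup>2 = \<delta>\<^sup>2\<close> that \<open>G\<close> does not use.\<close>
  have other: "G' = ?f -` ?Q (- x) \<and> (\<forall>P. generates (geometric_points E) G' P \<longrightarrow>
      (\<exists>y. ?f P = Affine (- x) y) \<and> ?f (ec_add ?W P P) = Affine 0 0)"
    if G': "stable_cyclic4 E G'" "G' \<noteq> G" "Affine 0 0 \<in> ?f ` G'" for G'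
  proof -
    have "cyclic_subgroup (geometric_points E) 4 G'"
      using G'(1) by (simp add: stable_cyclic4_def)
    then obtain x' where x': "x' = to_ac \<delta> \<or> x' = - to_ac \<delta>" "G' = ?f -` ?Q x'"
      "\<And>P. generates (geometric_points E) G' P \<Longrightarrow>
        (\<exists>y. ?f P = Affine x' y) \<and> ?f (ec_add ?W P P) = Affine 0 0"
      by (rule cyclic_4_over_origin[OF ctx _ G'(3)]) blast
    have "x' \<noteq> x"
      using x' G'(2) x(2) by blast
    then have "x' = - x"
      using x(1) x'(1) by auto
    then show ?thesis
      using x'(2,3) by blast
  qed
  show "\<exists>!G'. stable_cyclic4 E G' \<and> G' \<noteq> G \<and> Affine 0 0 \<in> ?f ` G'"
  proof (rule ex1I[of _ "?f -` ?Q (- x)"])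
    obtain e where e: "e = \<delta> \<or> e = - \<delta>" "- x = to_ac e"
      using x(1) by (metis minus_minus to_ac_minus)
    have "stable_cyclic4 E (?f -` ?Q (- x))"
      unfolding e(2) using e(1) by (rule stable_cyclic4_fibre[OF ctx])
    moreover have "?f -` ?Q (- x) \<noteq> G"
      unfolding x(2) using preimage_inj fibre_quadruple_inj \<open>x \<noteq> 0\<close> x_neq by metis
    ultimately show "stable_cyclic4 E (?f -` ?Q (- x)) \<and> ?f -` ?Q (- x) \<noteq> G \<and>
        Affine 0 0 \<in> ?f ` (?f -` ?Q (- x))"
      using origin_mem by blast
  qed (use other in blast)
  fix G'
  assume "stable_cyclic4 E G' \<and> G' \<noteq> G \<and> Affine 0 0 \<in> ?f ` G'"
  then have G': "stable_cyclic4 E G'" "G' \<noteq> G" "Affine 0 0 \<in> ?f ` G'"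
    by blast+
  note other = other[OF G']
  show "\<exists>\<xi>. (\<forall>P. generates (geometric_points E) G P \<longrightarrow> (\<exists>y. ?f P = Affine \<xi> y)) \<and>
      (\<forall>Q. generates (geometric_points E) G' Q \<longrightarrow> (\<exists>y. ?f Q = Affine (- \<xi>) y))"
    using genG other by blast
  let ?T = "Affine (to_ac r) (to_ac t) :: qbar ec_point"
  have T: "?f P = Affine 0 0 \<longleftrightarrow> P = ?T" for P
    using to_model_eq_iff[OF ctx, of P ?T] by simp
  have "G \<inter> G' = ?f -` (?Q x \<inter> ?Q (- x))"
    unfolding x(2) using other by blast
  also have "\<dots> = {Infinity, ?T}"
    using x_neq by (subst fibre_quadruple_Int) (auto simp: T to_model_Infinity[OF ctx])
  finally have Int: "G \<inter> G' = {Infinity, ?T}" .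
  have order_two: "order_two_subgroups (geometric_points E) H = {G \<inter> G'}"
    if H: "stable_cyclic4 E H"
      and "\<And>P. generates (geometric_points E) H P \<Longrightarrow> ?f (ec_add ?W P P) = Affine 0 0" for H
  proof -
    obtain P where P: "generates (geometric_points E) H P"
      using H by (auto simp: stable_cyclic4_def cyclic_subgroup_def)
    then have "ec_add ?W P P = ?T"
      using that(2) T by blast
    then show ?thesis
      using order_two_subgroups_cyclic_4[of H ?W P] H P unfolding Int
      by (simp add: stable_cyclic4_def cyclic_subgroup_def geometric_points_def)
  qed
  show "order_two_subgroups (geometric_points E) G = {G \<inter> G'}"
    using genG by (intro order_two assms(2)) blast
  show "order_two_subgroups (geometric_points E) G' = {G \<inter> G'}"
    using other by (intro order_two G'(1)) blast
  fix S assume "generates (geometric_points E) (G \<inter> G') S"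
  then have "S = map_ec_point to_ac (Affine r t)"
    unfolding Int geometric_points_def using generator_of_order_two_subgroup by force
  then show "rational_point S"
    unfolding rational_point_def by blast
qed

end
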